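(* Consider the Haar basis, and for $n\ge2$ let $\Gamma_n=\{\lambda=(j,k)\in\Lambda:\ j\le j_0\}$ with $j_0=j_0(n)$ the integer such that $2^{j_0}\le n(\log n)^{-1}<2^{j_0+1}$, and $\Gamma=(\Gamma_n)_n$. Let $0<s<\frac12$ and $R,R',R''>0$ be such that $R''\ge1$ and $R'\ge R^{1-2s}\ge1$. Then, with $\rho_{n,s}=\left(\frac{\log n}{n}\right)^s$, $$\liminf_{n\to\infty}\ \rho_{n,s}^{-2}\ \inf_{\hat f_n}\ \sup_{f\in W_s(R)\cap B^s_{2,\Gamma}(R')\cap\mathcal{L}_{1,2,\infty}(R'')}\mathbb{E}\big(\|\hat f_n-f\|_2^2\big)\ \ge\ \tilde C(s)\,R^{2-4s},$$ where the infimum is over all estimators $\hat f_n$ based on $N$, and $\tilde C(s)>0$ depends only on $s$ and the Haar functions $\Phi$.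
   Context: **Poisson model.** For a positive integer $n$, $N$ is a Poisson process on $\mathbb{R}$ with mean measure $n f(x)\,dx$, where $f\ge 0$, $f\in\mathbb{L}_1(\mathbb{R})\cap\mathbb{L}_2(\mathbb{R})$; $f$ is called the intensity. Suprema over $f$ are over intensities (nonnegative functions) in the given class. An estimator is a measurable function of $N$. **Haar basis.** $\phi=1_{[0,1]}$, $\psi=1_{[0,1/2]}-1_{]1/2,1]}$, $\Phi=\{\phi,\psi\}$; $\Lambda=\{(j,k):j\ge-1,k\in\mathbb{Z}\}$; $\varphi_\lambda(x)=\phi(x-k)$ if $\lambda=(-1,k)$ and $\varphi_\lambda(x)=2^{j/2}\psi(2^jx-k)$ if $\lambda=(j,k)$, $j\ge0$. This is an orthonormal basis: $f=\sum_{\lambda}\beta_\lambda\varphi_\lambda$, $\beta_\lambda=\int\varphi_\lambda f$. Set $\sigma_\lambda^2=\int\varphi_\lambda^2(x)f(x)dx$, $\sigma_\lambda\ge0$. **Classes** (viewed as sequence spaces, through the coefficients): $W_s(R)=\{f=\sum_\lambda\beta_\lambda\varphi_\lambda:\ \sup_{t>0}t^{-4s}\sum_{\lambda\in\Lambda}\beta_\lambda^21_{|\beta_\lambda|\le\sigma_\lambda t}\le R^{2-4s}\}$; $B^s_{2,\Gamma}(R)=\{f=\sum_\lambda\beta_\lambda\varphi_\lambda:\ \sup_{n\ge2}\left(\frac{\log n}{n}\right)^{-2s}\sum_{\lambda\in\Lambda\setminus\Gamma_n}\beta_\lambda^2\le R^2\}$; $\mathcal{L}_{1,2,\infty}(R)=\{f:\|f\|_1\le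 R,\|f\|_2\le R,\|f\|_\infty\le R\}$. *)

theory Defs
  imports "HOL-Probability.Probability"
begin

subsection \<open>Poisson processes on the real line\<close>

text \<open>Realisations of a point process are locally finite integer-valued Borel measures. As for
  \<^const>\<open>subprob_algebra\<close>, the sigma-algebra is the one generated by the counts
  \<open>N \<mapsto> N(A)\<close>, for \<open>A\<close> Borel.\<close>

definition point_measures :: "real measure set" where
  "point_measures =
    {N. sets N = sets borel \<and> (\<forall>A\<in>sets borel. bounded A \<longrightarrow> emeasure N A \<in> range (of_nat :: nat \<Rightarrow> ennreal))}"

definition point_algebra :: "real measure measure" where
  "point_algebra = (SUP A \<in> sets borel. vimage_algebra point_measures (\<lambda>N. emeasure N A) borel)"

lemma space_point_algebra: "space point_algebra = point_measures"
  by (auto simp: point_algebra_def space_Sup_eq_UN)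

text \<open>\<open>poisson_process_law \<mu> P\<close>: \<open>P\<close> is the law, on the space of point measures, of a Poisson
  process with mean measure \<open>\<mu>\<close>. The Poisson probabilities are spelled out because the library's
  \<open>poisson_pmf\<close> only makes sense for a positive rate, whereas \<open>\<mu>(A) = 0\<close> must be allowed.\<close>

definition poisson_process_law :: "real measure \<Rightarrow> real measure measure \<Rightarrow> bool" where
  "poisson_process_law \<mu> P \<longleftrightarrow>
     prob_space P \<and> sets P = sets point_algebra \<and>
     (\<forall>A\<in>sets borel. emeasure \<mu> A < \<infinity> \<longrightarrow>
        (\<forall>k::nat. measure P {N \<in> space P. emeasure N A = of_nat k}
           = exp (- measure \<mu> A) * measure \<mu> A ^ k / fact k)) \<and>
     (\<forall>(m::nat) (A :: nat \<Rightarrow> real set).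
        A ` {..<m} \<subseteq> sets borel \<and> disjoint_family_on A {..<m} \<longrightarrow>
        prob_space.indep_vars P (\<lambda>_. borel :: ennreal measure) (\<lambda>i N. emeasure N (A i)) {..<m})"

text \<open>The law is determined by the mean measure, so for an intensity \<open>f\<close> the following set is a
  singleton.\<close>

definition poisson_laws :: "nat \<Rightarrow> (real \<Rightarrow> real) \<Rightarrow> real measure measure set" where
  "poisson_laws n f = {P. poisson_process_law (density lborel (\<lambda>x. ennreal (real n * f x))) P}"

definition L1_fun :: "(real \<Rightarrow> real) set" where
  "L1_fun = {f. integrable lborel f}"

definition L2_fun :: "(real \<Rightarrow> real) set" where
  "L2_fun = {f \<in> borel_measurable lborel. integrable lborel (\<lambda>x. (f x)\<^sup>2)}"

definition intensities :: "(real \<Rightarrow> real) set" where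
  "intensities = {f \<in> L1_fun \<inter> L2_fun. \<forall>x. 0 \<le> f x}"

text \<open>A function-valued estimator is measurable when it is jointly measurable in the observation
  and the argument. It need not be nonnegative or square integrable; in the latter case its loss
  is \<open>\<infinity>\<close>.\<close>

definition estimators :: "(real measure \<Rightarrow> real \<Rightarrow> real) set" where
  "estimators = {g. (\<lambda>(N, x). g N x) \<in> borel_measurable (point_algebra \<Otimes>\<^sub>M lborel)}"

definition L2_risk :: "real measure measure \<Rightarrow> (real measure \<Rightarrow> real \<Rightarrow> real) \<Rightarrow> (real \<Rightarrow> real) \<Rightarrow> ennreal" where
  "L2_risk P g f = (\<integral>\<^sup>+ N. (\<integral>\<^sup>+ x. ennreal ((g N x - f x)\<^sup>2) \<partial>lborel) \<partial>P)"

subsection \<open>The Haar basis\<close>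

definition haar_phi :: "real \<Rightarrow> real" where
  "haar_phi = indicator {0..1}"

definition haar_psi :: "real \<Rightarrow> real" where
  "haar_psi x = indicator {0..1/2} x - indicator {1/2<..1} x"

definition Lam :: "(int \<times> int) set" where
  "Lam = {(j, k). -1 \<le> j}"

fun haar :: "int \<times> int \<Rightarrow> real \<Rightarrow> real" where
  "haar (j, k) x =
     (if j = -1 then haar_phi (x - of_int k)
      else 2 powr (of_int j / 2) * haar_psi (2 powr of_int j * x - of_int k))"

definition coef :: "(real \<Rightarrow> real) \<Rightarrow> int \<times> int \<Rightarrow> real" where
  "coef f l = (\<integral>x. haar l x * f x \<partial>lborel)"

definition sigma_coef :: "(real \<Rightarrow> real) \<Rightarrow> int \<times> int \<Rightarrow> real" where
  "sigma_coef f l = sqrt (\<integral>x. (haar l x)\<^sup>2 * f x \<partial>lborel)"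

subsection \<open>Function classes\<close>

text \<open>For \<open>f\<close> in \<open>L\<^sub>2\<close> the expansion of \<open>f\<close> in the Haar basis holds automatically.
  The sums and suprema are taken in \<^typ>\<open>ennreal\<close>, so that an infinite value violates the bound.\<close>

definition W_class :: "real \<Rightarrow> real \<Rightarrow> (real \<Rightarrow> real) set" where
  "W_class s R = {f \<in> L2_fun.
     (SUP t\<in>{0<..}. ennreal (t powr (- 4 * s)) *
        (\<Sum>\<^sub>\<infinity>l\<in>Lam. ennreal ((coef f l)\<^sup>2 * of_bool (\<bar>coef f l\<bar> \<le> sigma_coef f l * t))))
     \<le> ennreal (R powr (2 - 4 * s))}"

definition B_class :: "real \<Rightarrow> (nat \<Rightarrow> (int \<times> int) set) \<Rightarrow> real \<Rightarrow> (real \<Rightarrow> real) set" where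
  "B_class s \<Gamma> R = {f \<in> L2_fun.
     (SUP n\<in>{2..}. ennreal ((ln (real n) / real n) powr (- 2 * s)) *
        (\<Sum>\<^sub>\<infinity>l\<in>Lam - \<Gamma> n. ennreal ((coef f l)\<^sup>2)))
     \<le> ennreal (R\<^sup>2)}"

definition L_class :: "real \<Rightarrow> (real \<Rightarrow> real) set" where
  "L_class R = {f \<in> L1_fun \<inter> L2_fun.
     (\<integral>x. \<bar>f x\<bar> \<partial>lborel) \<le> R \<and>
     sqrt (\<integral>x. (f x)\<^sup>2 \<partial>lborel) \<le> R \<and>
     esssup lborel (\<lambda>x. ennreal \<bar>f x\<bar>) \<le> ennreal R}"

definition j0 :: "nat \<Rightarrow> int" where
  "j0 n = (THE j. 2 powr of_int j \<le> real n / ln (real n) \<and> real n / ln (real n) < 2 powr (of_int j + 1))"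

definition Gam :: "nat \<Rightarrow> (int \<times> int) set" where
  "Gam n = {(j, k) \<in> Lam. j \<le> j0 n}"

lemma j0_bounds:
  assumes "2 \<le> n"
  shows "2 powr of_int (j0 n) \<le> real n / ln (real n)"
    and "real n / ln (real n) < 2 powr (of_int (j0 n) + 1)"
proof -
  define y where "y = real n / ln (real n)"
  have y: "0 < y" using assms by (simp add: y_def)
  have eq: "2 powr of_int j \<le> y \<and> y < 2 powr (of_int j + 1) \<longleftrightarrow> j = \<lfloor>log 2 y\<rfloor>" for j :: int
    proof -
    have "2 powr of_int j \<le> y \<longleftrightarrow> of_int j \<le> log 2 y"
      using y by (simp add: le_log_iff)
    moreover have "y < 2 powr (of_int j + 1) \<longleftrightarrow> log 2 y < of_int j + 1"
      using y by (simp add: log_less_iff)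
    ultimately show ?thesis by (metis floor_eq_iff)
  qed
  have "2 powr of_int (j0 n) \<le> y \<and> y < 2 powr (of_int (j0 n) + 1)"
    unfolding j0_def y_def[symmetric] eq by simp
  then show "2 powr of_int (j0 n) \<le> real n / ln (real n)"
    and "real n / ln (real n) < 2 powr (of_int (j0 n) + 1)" by (auto simp: y_def)
qed

end

theory Submission
  imports Defs "HOL-Combinatorics.Multiset_Permutations" "HOL-Real_Asymp.Real_Asymp"
begin

text \<open>The hard intensities are indicators of \<open>[0,1)\<close> with small holes in it. Cut \<open>[0,1)\<close> into \<open>m = 2^I\<close>
  blocks, cut every block into \<open>L = 2^(J-I)\<close> cells of length \<open>2^(-J)\<close>, and remove one cell from each
  block. Two positions of the hole in a block are at squared \<open>L\<^sub>2\<close> distance \<open>2 * 2^(-J)\<close>, so an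
  estimator that cannot locate the holes loses at least a fixed fraction of \<open>m * 2^(-J)\<close>.

  The holes cannot be located because the Poisson process with intensity \<open>n\<close> times the indicator of
  a carved set is the one with intensity \<open>n\<close> times the indicator of \<open>[0,1)\<close>, conditioned on having
  no point in the holes (\<open>poisson_process_law_void\<close>). All the competing laws thus have constant density \<open>q^(-m)\<close> on an event of the same base law, where
  \<open>q = exp (-n * 2^(-J))\<close> is the probability that a given cell is empty. If the holes are placed
  uniformly at random, then given the data every empty cell of a block is equally likely to be the
  hole of that block. Under the base law a block has \<open>L * q\<close> empty cells on average; as soon as this number
  is at least \<open>2\<close>, averaging over all positions of the holes shows that some configuration has risk
  at least \<open>m * 2^(-J) / 4\<close> (\<open>hard_configuration\<close>, \<open>risk_lower_bound\<close>). The logarithm in the rate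
  comes from here: a cell of length of order \<open>ln n / n\<close> and at most \<open>s * ln n / n\<close> is expected to contain
  many points, yet it is empty with probability at least \<open>n^(-s)\<close>, and for such cells \<open>L\<close> is, up to
  logarithms, of order \<open>n^(2 * s)\<close>.

  The indicator of a carved set has a sparse Haar expansion. The coefficients vanish at levels
  \<open>j \<ge> J\<close>, since the set is a union of cells of level \<open>J\<close>, and at levels \<open>0 \<le> j < I\<close>, since all blocks lose
  the same mass. At a level \<open>I \<le> j < J\<close> there are exactly \<open>m\<close> nonzero coefficients, all of absolute
  value \<open>2^(j/2) / 2^J\<close>; the energies grow geometrically in \<open>j\<close>, so that the finest active level
  dominates, and \<open>m \<le> R^(2-4s) * (2^J)^(1-2s) / 4\<close> suffices for both \<open>W_class\<close> and \<open>B_class\<close>. The one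
  remaining coefficient is the mass \<open>\<beta>\<close> of the set, with \<open>\<sigma>\<^sup>2 = \<beta>\<close>; it is counted in \<open>W_class\<close> only for
  \<open>t\<^sup>2 \<ge> \<beta>\<close>, when even the whole energy, which is \<open>\<beta>\<close>, is at most \<open>\<beta>^(2s) \<le> t^(4s)\<close>.

  With \<open>2^J\<close> of order \<open>n / ln n\<close> and \<open>m\<close> as large as the classes permit, \<open>m * 2^(-J)\<close> has the order
  \<open>R^(2-4s) * (ln n / n)^(2s)\<close> of the claim. A supremum over an empty set of laws would be zero, so
  the base process also has to be constructed (\<open>poisson_process_law_exists\<close>).\<close>

section \<open>Poisson processes with finite mean measure exist\<close>

definition hits :: "real set \<Rightarrow> nat \<times> (nat \<Rightarrow> real) \<Rightarrow> nat" where
  "hits A \<omega> = card {i. i < fst \<omega> \<and> snd \<omega> i \<in> A}"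

text \<open>The sum of unit masses at the first \<open>fst \<omega>\<close> terms of the sequence \<open>snd \<omega>\<close>; pushing forward
  the counting measure keeps multiplicities.\<close>

definition scatter :: "nat \<times> (nat \<Rightarrow> real) \<Rightarrow> real measure" where
  "scatter \<omega> = distr (count_space {..<fst \<omega>}) borel (snd \<omega>)"

lemma emeasure_scatter:
  assumes "A \<in> sets borel"
  shows "emeasure (scatter \<omega>) A = of_nat (hits A \<omega>)"
proof -
  have eq: "snd \<omega> -` A \<inter> {..<fst \<omega>} = {i. i < fst \<omega> \<and> snd \<omega> i \<in> A}" by auto
  have "emeasure (count_space {..<fst \<omega>}) {i. i < fst \<omega> \<and> snd \<omega> i \<in> A} = of_nat (card {i. i < fst \<omega> \<and> snd \<omega> i \<in> A})"
    by (rule emeasure_count_space_finite) auto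
  with assms show ?thesis
    unfolding scatter_def hits_def by (subst emeasure_distr) (auto simp: eq)
qed

lemma scatter_in_point_measures: "scatter \<omega> \<in> point_measures"
  unfolding point_measures_def by (auto simp: emeasure_scatter) (auto simp: scatter_def)

definition poisson_sample :: "real \<Rightarrow> real measure \<Rightarrow> (nat \<times> (nat \<Rightarrow> real)) measure" where
  "poisson_sample r U = measure_pmf (poisson_pmf r) \<Otimes>\<^sub>M (\<Pi>\<^sub>M i\<in>UNIV. U)"

text \<open>For a deterministic number of points the count is built up one point at a time; the random number
  of points takes countably many values.\<close>

lemma measurable_hits [measurable]:
  assumes U: "sets U = sets borel" and A: "A \<in> sets borel"
  shows "hits A \<in> measurable (poisson_sample r U) (count_space UNIV)"
proof -
  have [measurable]: "A \<in> sets U" using assms by simp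
  have fixed: "(\<lambda>\<omega>. card {i. i < k \<and> snd \<omega> i \<in> A}) \<in> measurable (poisson_sample r U) (count_space UNIV)" for k
  proof (induction k)
    case 0
    then show ?case by simp
  next
    case (Suc k)
    have eq: "card {i. i < Suc k \<and> snd \<omega> i \<in> A} =
        (if snd \<omega> k \<in> A then Suc (card {i. i < k \<and> snd \<omega> i \<in> A}) else card {i. i < k \<and> snd \<omega> i \<in> A})"
      for \<omega> :: "nat \<times> (nat \<Rightarrow> real)"
    proof -
      have "{i. i < Suc k \<and> snd \<omega> i \<in> A} = (if snd \<omega> k \<in> A then insert k {i. i < k \<and> snd \<omega> i \<in> A}
          else {i. i < k \<and> snd \<omega> i \<in> A})"
        by (auto simp: less_Suc_eq)
      then show ?thesis by simp
    qed
    have [measurable]: "(\<lambda>\<omega>. snd \<omega> k) \<in> measurable (poisson_sample r U) U"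
      unfolding poisson_sample_def by measurable
    have [measurable]: "Measurable.pred (poisson_sample r U) (\<lambda>\<omega>. snd \<omega> k \<in> A)"
      by (rule pred_sets2[of A U]) measurable
    show ?case
      unfolding eq
    proof (rule measurable_If)
      show "(\<lambda>\<omega>. Suc (card {i. i < k \<and> snd \<omega> i \<in> A})) \<in> measurable (poisson_sample r U) (count_space UNIV)"
        by (rule measurable_compose[OF Suc]) simp
      show "{\<omega> \<in> space (poisson_sample r U). snd \<omega> k \<in> A} \<in> sets (poisson_sample r U)"
        by (rule predE) fact
    qed (rule Suc)
  qed
  have [measurable]: "fst \<in> measurable (poisson_sample r U) (count_space UNIV)"
    unfolding poisson_sample_def by measurable
  show ?thesis
    unfolding hits_def
    by (rule measurable_compose_countable'[where f = "\<lambda>k \<omega>. card {i. i < k \<and> snd \<omega> i \<in> A}" and g = fst and I = UNIV, OF fixed]) (auto simp: poisson_sample_def)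
qed

lemma measurable_scatter:
  assumes U: "sets U = sets borel"
  shows "scatter \<in> measurable (poisson_sample r U) point_algebra"
  unfolding point_algebra_def
proof (rule measurable_SUP2)
  fix A :: "real set" assume A: "A \<in> sets borel"
  have "(\<lambda>\<omega>. emeasure (scatter \<omega>) A) \<in> borel_measurable (poisson_sample r U)"
    using measurable_compose[OF measurable_hits[OF U A], of of_nat borel r] A
    by (simp add: emeasure_scatter)
  then show "scatter \<in> measurable (poisson_sample r U) (vimage_algebra point_measures (\<lambda>N. emeasure N A) borel)"
    by (intro measurable_vimage_algebra2) (auto simp: scatter_in_point_measures)
next
  show "sets borel \<noteq> ({} :: real set set)" by (metis empty_iff sets.empty_sets)
qed simp

lemma prob_space_poisson_sample:
  assumes "prob_space U"
  shows "prob_space (poisson_sample r U)"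
proof -
  interpret P: product_prob_space "\<lambda>_. U" "UNIV :: nat set"
    using assms by (simp add: product_prob_spaceI)
  interpret A: prob_space "measure_pmf (poisson_pmf r)" by (rule measure_pmf.prob_space_axioms)
  interpret Q: pair_prob_space "measure_pmf (poisson_pmf r)" "\<Pi>\<^sub>M i\<in>(UNIV::nat set). U" ..
  show ?thesis unfolding poisson_sample_def by (rule Q.prob_space_axioms)
qed

text \<open>A list \<open>xs\<close> of cell labels prescribes both the number of points and the cell of each point. These
  events are product sets, and every event about the counts of a finite partition is a finite
  union of them.\<close>

lemma emeasure_poisson_sample_labels:
  assumes U: "prob_space U" and A: "\<And>x. x \<in> set xs \<Longrightarrow> A x \<in> sets U" and r: "0 < r"
  shows "emeasure (poisson_sample r U) {\<omega>\<in>space (poisson_sample r U). fst \<omega> = length xs \<and> (\<forall>i<length xs. snd \<omega> i \<in> A (xs ! i))}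
    = ennreal (exp (- r) * r ^ length xs / fact (length xs) * (\<Prod>x\<leftarrow>xs. measure U (A x)))" (is ?E)
    and "{\<omega>\<in>space (poisson_sample r U). fst \<omega> = length xs \<and> (\<forall>i<length xs. snd \<omega> i \<in> A (xs ! i))} \<in> sets (poisson_sample r U)" (is ?S)
proof -
  interpret U: prob_space U by fact
  interpret P: product_prob_space "\<lambda>_. U" "UNIV :: nat set"
    using assms by (simp add: product_prob_spaceI)
  let ?B = "{u\<in>space (\<Pi>\<^sub>M i\<in>UNIV. U). \<forall>i\<in>{..<length xs}. u i \<in> A (xs ! i)}"
  have A': "A (xs ! i) \<in> sets U" if "i < length xs" for i using A that by simp
  have Bm: "?B \<in> sets (\<Pi>\<^sub>M i\<in>UNIV. U)"
  proof (rule sets.sets_Collect_finite_All)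
    fix i assume "i \<in> {..<length xs}"
    then show "{u\<in>space (\<Pi>\<^sub>M i\<in>UNIV. U). u i \<in> A (xs ! i)} \<in> sets (\<Pi>\<^sub>M i\<in>UNIV. U)"
      using A' by (intro sets_Collect_single') auto
  qed auto
  have eq: "{\<omega>\<in>space (poisson_sample r U). fst \<omega> = length xs \<and> (\<forall>i<length xs. snd \<omega> i \<in> A (xs ! i))} = {length xs} \<times> ?B"
    by (auto simp: poisson_sample_def space_pair_measure)
  show ?S
    unfolding eq unfolding poisson_sample_def by (rule pair_measureI) (use Bm in auto)
  note eq
  moreover have "emeasure (poisson_sample r U) ({length xs} \<times> ?B)
      = emeasure (measure_pmf (poisson_pmf r)) {length xs} * emeasure (\<Pi>\<^sub>M i\<in>UNIV. U) ?B"
    unfolding poisson_sample_def by (rule P.emeasure_pair_measure_Times) (use Bm in auto)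
  moreover have "emeasure (\<Pi>\<^sub>M i\<in>UNIV. U) ?B = (\<Prod>i<length xs. emeasure U (A (xs ! i)))"
    by (rule P.emeasure_PiM_Collect) (use A' in auto)
  moreover have "(\<Prod>i<length xs. emeasure U (A (xs ! i))) = ennreal (\<Prod>x\<leftarrow>xs. measure U (A x))"
    by (simp add: U.emeasure_eq_measure prod_ennreal prod.list_conv_set_nth atLeast0LessThan)
  moreover have "emeasure (measure_pmf (poisson_pmf r)) {length xs} = ennreal (exp (- r) * r ^ length xs / fact (length xs))"
    using r by (simp add: emeasure_pmf_single mult_ac)
  ultimately show ?E using r
    by (simp add: ennreal_mult' [symmetric])
qed

text \<open>The counts of a partition are independent Poisson variables. The event that cell \<open>j\<close> is hit
  \<open>k j\<close> times is the disjoint union, over the orderings of the multiset with \<open>k j\<close> copies of each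
  \<open>j\<close>, of the labelling events above. All orderings are equally likely, and their number is a
  multinomial coefficient, whose numerator cancels the factorial in the Poisson probability of
  the total number of points.\<close>

lemma hits_joint_pmf:
  fixes A :: "nat \<Rightarrow> real set"
  assumes U: "prob_space U" "sets U = sets borel" and r: "0 < r"
    and A: "\<And>j. j < M \<Longrightarrow> A j \<in> sets borel" "disjoint_family_on A {..<M}" "(\<Union>j<M. A j) = UNIV"
  shows "emeasure (poisson_sample r U) {\<omega>\<in>space (poisson_sample r U). \<forall>j<M. hits (A j) \<omega> = k j}
    = ennreal (\<Prod>j<M. exp (- (r * measure U (A j))) * (r * measure U (A j)) ^ k j / fact (k j))"
proof -
  interpret U: prob_space U by fact
  define p where "p j = measure U (A j)" for j
  define lab where "lab x = (THE j. j < M \<and> x \<in> A j)" for x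
  have lab: "lab x = j \<longleftrightarrow> x \<in> A j" "lab x < M" if "j < M" for x j
  proof -
    have "x \<in> (\<Union>j<M. A j)" using A(3) by simp
    then obtain i where i: "i < M" "x \<in> A i" by blast
    have uniq: "i' = i" if "i' < M" "x \<in> A i'" for i'
      using A(2) that i unfolding disjoint_family_on_def by blast
    have "lab x = i" unfolding lab_def
    proof (rule the_equality)
      show "i < M \<and> x \<in> A i" using i by blast
    qed (use uniq in blast)
    then show "lab x = j \<longleftrightarrow> x \<in> A j" "lab x < M" using i uniq[OF \<open>j < M\<close>] by blast+
  qed
  define labels where "labels \<omega> = map (\<lambda>i. lab (snd \<omega> i)) [0..<fst \<omega>]" for \<omega> :: "nat \<times> (nat \<Rightarrow> real)"
  have hits_labels: "hits (A j) \<omega> = count (mset (labels \<omega>)) j" if "j < M" for j \<omega>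
  proof -
    have "count (mset (labels \<omega>)) j = card {i. i < length (labels \<omega>) \<and> j = labels \<omega> ! i}"
      by (simp only: count_mset count_list_eq_length_filter length_filter_conv_card)
    also have "{i. i < length (labels \<omega>) \<and> j = labels \<omega> ! i} = {i. i < fst \<omega> \<and> snd \<omega> i \<in> A j}"
    proof -
      have "j = lab x \<longleftrightarrow> x \<in> A j" for x using lab(1)[OF that, of x] by (simp add: eq_commute[of j])
      then show ?thesis unfolding labels_def by (intro Collect_cong conj_cong) simp_all
    qed
    finally show ?thesis by (simp add: hits_def)
  qed
  define K where "K = (\<Sum>j<M. k j)"
  define Q where "Q = (\<Sum>j<M. replicate_mset (k j) j)"
  have count_Q: "count Q j = (if j < M then k j else 0)" for j
    by (simp add: Q_def count_sum)
  have size_Q: "size Q = K" by (simp add: Q_def K_def size_multiset_sum)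
  have set_Q: "set_mset Q \<subseteq> {..<M}"
    by (auto simp: count_Q set_mset_def split: if_splits)
  have M: "0 < M" using A(3) by (cases M) auto
  define E where "E xs = {\<omega>\<in>space (poisson_sample r U). fst \<omega> = length xs \<and> (\<forall>i<length xs. snd \<omega> i \<in> A (xs ! i))}" for xs
  have E: "E xs = {\<omega>\<in>space (poisson_sample r U). labels \<omega> = xs}" if "set xs \<subseteq> {..<M}" for xs
  proof -
    have "xs ! i < M" if "i < length xs" for i using \<open>set xs \<subseteq> {..<M}\<close> nth_mem[OF that] by blast
    then have "(\<forall>i<length xs. snd \<omega> i \<in> A (xs ! i)) \<longleftrightarrow> (\<forall>i<length xs. lab (snd \<omega> i) = xs ! i)" for \<omega> :: "nat \<times> (nat \<Rightarrow> real)"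
      using lab(1) by blast
    moreover have "labels \<omega> = xs \<longleftrightarrow> fst \<omega> = length xs \<and> (\<forall>i<length xs. lab (snd \<omega> i) = xs ! i)" for \<omega>
      unfolding list_eq_iff_nth_eq labels_def by auto
    ultimately show ?thesis unfolding E_def by (simp only:)
  qed
  have setxs: "set xs \<subseteq> {..<M}" "length xs = K" "mset xs = Q" if "xs \<in> permutations_of_multiset Q" for xs
  proof -
    show *: "mset xs = Q" using that by (rule permutations_of_multisetD)
    show "set xs \<subseteq> {..<M}" using set_Q unfolding *[symmetric] by simp
    show "length xs = K" using size_Q unfolding *[symmetric] by simp
  qed
  have ev: "{\<omega>\<in>space (poisson_sample r U). \<forall>j<M. hits (A j) \<omega> = k j} = (\<Union>xs\<in>permutations_of_multiset Q. E xs)"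
  proof -
    have iff: "(\<forall>j<M. hits (A j) \<omega> = k j) \<longleftrightarrow> labels \<omega> \<in> permutations_of_multiset Q" for \<omega>
    proof -
      have "count (mset (labels \<omega>)) j = 0" if "\<not> j < M" for j
      proof -
        have "lab x \<noteq> j" for x using that lab(2)[OF M, of x] by blast
        then have "j \<notin> set (labels \<omega>)" by (auto simp: labels_def)
        then show ?thesis by (simp add: count_eq_zero_iff)
      qed
      then have "(\<forall>j<M. hits (A j) \<omega> = k j) \<longleftrightarrow> mset (labels \<omega>) = Q"
        unfolding multiset_eq_iff count_Q using hits_labels by auto
      then show ?thesis by (simp add: permutations_of_multiset_def)
    qed
    have "(\<Union>xs\<in>permutations_of_multiset Q. E xs)
        = (\<Union>xs\<in>permutations_of_multiset Q. {\<omega>\<in>space (poisson_sample r U). labels \<omega> = xs})"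
      by (rule SUP_cong) (simp_all add: E setxs(1))
    then show ?thesis unfolding iff by auto
  qed
  have E_meas: "E xs \<in> sets (poisson_sample r U)" if "xs \<in> permutations_of_multiset Q" for xs
    using emeasure_poisson_sample_labels(2)[of U xs A r] setxs(1)[OF that] U r A(1)
    by (auto simp: E_def subset_eq)
  have prodp: "(\<Prod>x\<leftarrow>xs. p x) = (\<Prod>j<M. p j ^ k j)" if "xs \<in> permutations_of_multiset Q" for xs
  proof -
    have "(\<Prod>x\<leftarrow>xs. p x) = prod_mset (image_mset p Q)"
      using setxs(3)[OF that] by (metis mset_map prod_mset_prod_list)
    also have "\<dots> = (\<Prod>j\<in>set_mset Q. p j ^ count Q j)"
      by (rule image_prod_mset_multiplicity)
    also have "\<dots> = (\<Prod>j<M. p j ^ count Q j)"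
      using set_Q by (intro prod.mono_neutral_left) (simp_all add: not_in_iff)
    finally show ?thesis by (simp add: count_Q)
  qed
  have em: "emeasure (poisson_sample r U) (E xs) = ennreal (exp (- r) * r ^ K / fact K * (\<Prod>j<M. p j ^ k j))"
    if "xs \<in> permutations_of_multiset Q" for xs
    using emeasure_poisson_sample_labels(1)[of U xs A r] setxs[OF that] prodp[OF that] U r A(1)
    by (auto simp: E_def p_def subset_eq)
  have "emeasure (poisson_sample r U) (\<Union>xs\<in>permutations_of_multiset Q. E xs)
      = (\<Sum>xs\<in>permutations_of_multiset Q. emeasure (poisson_sample r U) (E xs))"
  proof (rule sum_emeasure[symmetric])
    show "E ` permutations_of_multiset Q \<subseteq> sets (poisson_sample r U)" using E_meas by blast
    show "disjoint_family_on E (permutations_of_multiset Q)"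
      unfolding disjoint_family_on_def using E setxs(1) by auto
  qed simp
  also have "\<dots> = ennreal (real (card (permutations_of_multiset Q)) * (exp (- r) * r ^ K / fact K * (\<Prod>j<M. p j ^ k j)))"
    using r by (simp add: em ennreal_mult'[symmetric] ennreal_of_nat_eq_real_of_nat)
  also have "real (card (permutations_of_multiset Q)) * (exp (- r) * r ^ K / fact K * (\<Prod>j<M. p j ^ k j))
      = (\<Prod>j<M. exp (- (r * p j)) * (r * p j) ^ k j / fact (k j))"
  proof -
    have "card (permutations_of_multiset Q) * (\<Prod>j\<in>set_mset Q. fact (count Q j)) = fact K"
      using card_permutations_of_multiset_aux[of Q] size_Q by simp
    moreover have "(\<Prod>j\<in>set_mset Q. fact (count Q j)) = (\<Prod>j<M. fact (k j) :: nat)"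
    proof -
      have "k j = 0" if "j < M" "j \<notin># Q" for j using that count_Q[of j] by (simp add: not_in_iff)
      then show ?thesis
        using set_Q by (subst prod.mono_neutral_left[of "{..<M}"]) (auto simp: count_Q)
    qed
    ultimately have "real (card (permutations_of_multiset Q) * (\<Prod>j<M. fact (k j) :: nat)) = real (fact K)"
      by simp
    then have card: "real (card (permutations_of_multiset Q)) = fact K / (\<Prod>j<M. fact (k j))"
      by (simp add: field_simps)
    have "(\<Sum>j<M. p j) = 1"
    proof -
      have "(\<Sum>j<M. p j) = measure U (\<Union>j<M. A j)"
        unfolding p_def using A U(2) by (intro U.finite_measure_finite_Union[symmetric]) auto
      also have "\<dots> = 1" using A(3) U.prob_space sets_eq_imp_space_eq[OF U(2)] by simp
      finally show ?thesis .
    qed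
    then have "(\<Prod>j<M. exp (- (r * p j))) = exp (- r)"
      by (simp add: exp_sum[symmetric] sum_negf sum_distrib_left[symmetric])
    then show ?thesis
      by (simp add: card prod.distrib prod_dividef power_mult_distrib K_def power_sum)
  qed
  finally show ?thesis using ev by (simp add: p_def)
qed

text \<open>Extends the Poisson distributions by the point mass at \<open>0\<close> for rate \<open>0\<close>, which is what the count
  of a null set follows.\<close>

definition poisson0_pmf :: "real \<Rightarrow> nat pmf" where
  "poisson0_pmf r = (if 0 < r then poisson_pmf r else return_pmf 0)"

lemma pmf_poisson0: "0 \<le> r \<Longrightarrow> pmf (poisson0_pmf r) k = exp (- r) * r ^ k / fact k"
  by (cases "r = 0"; cases k) (auto simp: poisson0_pmf_def)

text \<open>The vector of counts lives in a countable set of functions, hence its law is determined by its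
  point masses, and it must be the product law.\<close>

lemma hits_joint_law_partition:
  fixes A :: "nat \<Rightarrow> real set"
  assumes U: "prob_space U" "sets U = sets borel" and r: "0 < r"
    and A: "\<And>j. j < M \<Longrightarrow> A j \<in> sets borel" "disjoint_family_on A {..<M}" "(\<Union>j<M. A j) = UNIV"
  shows "measure (poisson_sample r U) {\<omega>\<in>space (poisson_sample r U). \<forall>j<M. hits (A j) \<omega> \<in> C j}
    = (\<Prod>j<M. measure (poisson0_pmf (r * measure U (A j))) (C j))"
proof -
  define q where "q j = poisson0_pmf (r * measure U (A j))" for j
  \<comment> \<open>values outside the index range are set to zero, which makes the range of the count vector countable\<close>
  define cut :: "(nat \<Rightarrow> nat) \<Rightarrow> nat \<Rightarrow> nat" where "cut f = (\<lambda>j. if j < M then f j else 0)" for f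
  define y where "y \<omega> = cut (\<lambda>j. hits (A j) \<omega>)" for \<omega>
  have cut_eq: "cut g = cut f \<longleftrightarrow> (\<forall>j<M. g j = f j)" for g f
    unfolding cut_def fun_eq_iff by meson
  have D: "countable (range cut)"
  proof -
    have "range cut \<subseteq> cut ` (PiE {..<M} (\<lambda>_. UNIV))"
    proof
      fix g assume "g \<in> range cut"
      then obtain f where "g = cut f" by auto
      then have "g = cut (restrict f {..<M})" by (auto simp: cut_def)
      moreover have "restrict f {..<M} \<in> PiE {..<M} (\<lambda>_. UNIV)" by simp
      ultimately show "g \<in> cut ` (PiE {..<M} (\<lambda>_. UNIV))" by (rule image_eqI)
    qed
    moreover have "countable (cut ` (PiE {..<M} (\<lambda>_. UNIV)))"
      by (rule countable_image[OF countable_PiE]) auto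
    ultimately show ?thesis by (rule countable_subset)
  qed
  have eqset: "y -` {cut f} \<inter> space (poisson_sample r U) = {\<omega>\<in>space (poisson_sample r U). \<forall>j<M. hits (A j) \<omega> = f j}" for f
    by (auto simp: y_def cut_eq)
  have meas_hits: "{\<omega>\<in>space (poisson_sample r U). \<forall>j<M. hits (A j) \<omega> \<in> B j} \<in> sets (poisson_sample r U)" for B
  proof -
    have "{\<omega>\<in>space (poisson_sample r U). \<forall>j\<in>{..<M}. hits (A j) \<omega> \<in> B j} \<in> sets (poisson_sample r U)"
    proof (rule sets.sets_Collect_finite_All)
      fix j assume "j \<in> {..<M}"
      then have "hits (A j) -` B j \<inter> space (poisson_sample r U) \<in> sets (poisson_sample r U)"
        using measurable_hits[OF U(2) A(1)] by (auto intro: measurable_sets)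
      then show "{\<omega>\<in>space (poisson_sample r U). hits (A j) \<omega> \<in> B j} \<in> sets (poisson_sample r U)"
        by (simp add: vimage_def Int_def conj_commute)
    qed simp
    then show ?thesis by (simp only: lessThan_iff Ball_def)
  qed
  have y: "y \<in> measurable (poisson_sample r U) (count_space (range cut))"
    unfolding measurable_count_space_eq_countable[OF D]
  proof (intro conjI ballI)
    show "y \<in> space (poisson_sample r U) \<rightarrow> range cut" unfolding y_def by blast
    fix a assume "a \<in> range cut"
    then obtain f where f: "a = cut f" by blast
    show "y -` {a} \<inter> space (poisson_sample r U) \<in> sets (poisson_sample r U)"
      unfolding f eqset using meas_hits[of "\<lambda>j. {f j}"] by (simp only: singleton_iff)
  qed
  have cut: "cut \<in> measurable (measure_pmf (Pi_pmf {..<M} 0 q)) (count_space (range cut))"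
    by simp
  have "distr (poisson_sample r U) (count_space (range cut)) y
      = distr (measure_pmf (Pi_pmf {..<M} 0 q)) (count_space (range cut)) cut"
  proof (rule measure_eqI_countable[OF _ _ D])
    fix a assume "a \<in> range cut"
    then obtain f where f: "a = cut f" by blast
    have "emeasure (distr (poisson_sample r U) (count_space (range cut)) y) {a}
      = ennreal (\<Prod>j<M. exp (- (r * measure U (A j))) * (r * measure U (A j)) ^ f j / fact (f j))"
      using f y by (simp add: emeasure_distr eqset hits_joint_pmf[OF U r A])
    also have "\<dots> = ennreal (\<Prod>j<M. pmf (q j) (f j))"
      using r by (simp add: q_def pmf_poisson0)
    also have "\<dots> = ennreal (measure (Pi_pmf {..<M} 0 q) (Pi {..<M} (\<lambda>j. {f j})))"
      by (subst measure_Pi_pmf_Pi) (auto simp: measure_pmf_single)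
    also have "Pi {..<M} (\<lambda>j. {f j}) = cut -` {a}"
      unfolding f using cut_eq by (auto simp: Pi_def)
    finally show "emeasure (distr (poisson_sample r U) (count_space (range cut)) y) {a}
      = emeasure (distr (measure_pmf (Pi_pmf {..<M} 0 q)) (count_space (range cut)) cut) {a}"
      using f cut by (simp add: emeasure_distr measure_pmf.emeasure_eq_measure)
  qed simp_all
  then have "measure (distr (poisson_sample r U) (count_space (range cut)) y) {g\<in>range cut. \<forall>j<M. g j \<in> C j}
      = measure (distr (measure_pmf (Pi_pmf {..<M} 0 q)) (count_space (range cut)) cut) {g\<in>range cut. \<forall>j<M. g j \<in> C j}"
    by simp
  moreover have "y -` {g\<in>range cut. \<forall>j<M. g j \<in> C j} \<inter> space (poisson_sample r U)
      = {\<omega>\<in>space (poisson_sample r U). \<forall>j<M. hits (A j) \<omega> \<in> C j}"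
    unfolding y_def by (auto simp: cut_def)
  moreover have "cut -` {g\<in>range cut. \<forall>j<M. g j \<in> C j} = Pi {..<M} C"
    by (auto simp: cut_def Pi_def)
  moreover have "measure (distr (poisson_sample r U) (count_space (range cut)) y) {g\<in>range cut. \<forall>j<M. g j \<in> C j}
      = measure (poisson_sample r U) (y -` {g\<in>range cut. \<forall>j<M. g j \<in> C j} \<inter> space (poisson_sample r U))"
    by (rule measure_distr[OF y]) auto
  moreover have "measure (distr (measure_pmf (Pi_pmf {..<M} 0 q)) (count_space (range cut)) cut) {g\<in>range cut. \<forall>j<M. g j \<in> C j}
      = measure (Pi_pmf {..<M} 0 q) (cut -` {g\<in>range cut. \<forall>j<M. g j \<in> C j} \<inter> space (Pi_pmf {..<M} 0 q))"
    by (rule measure_distr[OF cut]) auto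
  moreover have "measure (Pi_pmf {..<M} 0 q) (Pi {..<M} C) = (\<Prod>j<M. measure (q j) (C j))"
    by (rule measure_Pi_pmf_Pi) simp
  ultimately show ?thesis
    by (simp add: q_def)
qed

text \<open>Adjoining the complement of the given sets turns them into a partition, and no condition is
  imposed on the count of the complement.\<close>

lemma hits_joint_law:
  fixes A :: "nat \<Rightarrow> real set"
  assumes U: "prob_space U" "sets U = sets borel" and r: "0 < r"
    and A: "\<And>j. j < m \<Longrightarrow> A j \<in> sets borel" "disjoint_family_on A {..<m}"
  shows "measure (poisson_sample r U) {\<omega>\<in>space (poisson_sample r U). \<forall>j<m. hits (A j) \<omega> \<in> C j}
    = (\<Prod>j<m. measure (poisson0_pmf (r * measure U (A j))) (C j))"
proof -
  \<comment> \<open>label \<open>m\<close> stands for the complement\<close>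
  define A' where "A' j = (if j < m then A j else - (\<Union>j<m. A j))" for j
  define C' where "C' j = (if j < m then C j else UNIV)" for j
  have "measure (poisson_sample r U) {\<omega>\<in>space (poisson_sample r U). \<forall>j<Suc m. hits (A' j) \<omega> \<in> C' j}
    = (\<Prod>j<Suc m. measure (poisson0_pmf (r * measure U (A' j))) (C' j))"
  proof (rule hits_joint_law_partition[OF U r])
    have "(\<Union>j<m. A j) \<in> sets borel" using A(1) by (intro sets.finite_UN) auto
    from borel_comp[OF this] show "A' j \<in> sets borel" for j
      unfolding A'_def using A(1) by (cases "j < m") (simp_all only: if_True if_False)
    show "disjoint_family_on A' {..<Suc m}"
      using A(2) unfolding disjoint_family_on_def A'_def by (auto simp: less_Suc_eq)
    have "x \<in> (\<Union>j<Suc m. A' j)" for x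
    proof (cases "\<exists>j<m. x \<in> A j")
      case True
      then obtain j where "j < m" "x \<in> A j" by blast
      then show ?thesis by (intro UN_I[of j]) (auto simp: A'_def)
    next
      case False
      then show ?thesis by (intro UN_I[of m]) (auto simp: A'_def)
    qed
    then show "(\<Union>j<Suc m. A' j) = UNIV" by blast
  qed
  also have "{\<omega>\<in>space (poisson_sample r U). \<forall>j<Suc m. hits (A' j) \<omega> \<in> C' j}
      = {\<omega>\<in>space (poisson_sample r U). \<forall>j<m. hits (A j) \<omega> \<in> C j}"
    by (rule Collect_cong) (auto simp: A'_def C'_def less_Suc_eq)
  finally show ?thesis
    by (simp add: A'_def C'_def measure_pmf.prob_space[simplified])
qed

lemma measurable_count:
  "A \<in> sets borel \<Longrightarrow> (\<lambda>N. emeasure N A) \<in> borel_measurable point_algebra"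
  by (auto intro!: measurable_Sup1 measurable_vimage_algebra1 simp: point_algebra_def)

text \<open>A product formula for all Borel sets, in the shape in which joint laws of counts are computed here.\<close>

lemma (in prob_space) indep_vars_lessThanI:
  fixes X :: "nat \<Rightarrow> 'a \<Rightarrow> 'b :: topological_space"
  assumes X: "\<And>i. i < m \<Longrightarrow> random_variable borel (X i)"
    and eq: "\<And>B. (\<And>i. i < m \<Longrightarrow> B i \<in> sets borel) \<Longrightarrow>
      prob {x\<in>space M. \<forall>i<m. X i x \<in> B i} = (\<Prod>i<m. prob {x\<in>space M. X i x \<in> B i})"
  shows "indep_vars (\<lambda>_. borel) X {..<m}"
proof (cases "m = 0")
  case True
  then show ?thesis by (simp add: indep_vars_def indep_sets_def)
next
  case False
  show ?thesis
  proof (subst indep_vars_finite[where E = "\<lambda>_. sets borel"])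
    show "\<forall>B\<in>{..<m} \<rightarrow> sets borel. prob (\<Inter>j\<in>{..<m}. X j -` B j \<inter> space M)
      = (\<Prod>j\<in>{..<m}. prob (X j -` B j \<inter> space M))"
    proof
      fix B :: "nat \<Rightarrow> 'b set" assume B: "B \<in> {..<m} \<rightarrow> sets borel"
      have "(\<Inter>j\<in>{..<m}. X j -` B j \<inter> space M) = {x\<in>space M. \<forall>j<m. X j x \<in> B j}"
        using False by auto
      moreover have "X j -` B j \<inter> space M = {x\<in>space M. X j x \<in> B j}" for j by auto
      moreover have "prob {x\<in>space M. \<forall>j<m. X j x \<in> B j} = (\<Prod>j<m. prob {x\<in>space M. X j x \<in> B j})"
        using B by (intro eq) (auto simp: Pi_def)
      ultimately show "prob (\<Inter>j\<in>{..<m}. X j -` B j \<inter> space M) = (\<Prod>j\<in>{..<m}. prob (X j -` B j \<inter> space M))"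
        by (simp only:)
    qed
  qed (use False X in \<open>auto simp: Int_stable_def sets.sigma_sets_eq[of borel, simplified]\<close>)
qed

theorem poisson_process_law_exists:
  assumes U: "prob_space U" "sets U = sets borel" and r: "0 < r"
  shows "poisson_process_law (scale_measure (ennreal r) U) (distr (poisson_sample r U) point_algebra scatter)"
proof -
  interpret U: prob_space U by fact
  interpret R: prob_space "poisson_sample r U" by (rule prob_space_poisson_sample) fact
  let ?P = "distr (poisson_sample r U) point_algebra scatter"
  note sc = measurable_scatter[OF U(2), of r]
  interpret P: prob_space ?P by (rule R.prob_space_distr) fact
  have mu: "measure (scale_measure (ennreal r) U) A = r * measure U A" for A
    using r by (simp add: measure_def enn2real_mult)
  note count_meas = measurable_count
  have joint: "measure ?P {N\<in>space ?P. \<forall>j<m. emeasure N (A j) \<in> B j}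
      = (\<Prod>j<m. measure (poisson0_pmf (r * measure U (A j))) {k. of_nat k \<in> B j})"
    if A: "\<And>j. j < m \<Longrightarrow> A j \<in> sets borel" "disjoint_family_on A {..<m}"
      and B: "\<And>j. j < m \<Longrightarrow> B j \<in> sets borel" for m and A :: "nat \<Rightarrow> real set" and B :: "nat \<Rightarrow> ennreal set"
  proof -
    have "{N\<in>space point_algebra. \<forall>j\<in>{..<m}. emeasure N (A j) \<in> B j} \<in> sets point_algebra"
    proof (rule sets.sets_Collect_finite_All)
      fix j assume "j \<in> {..<m}"
      then show "{N\<in>space point_algebra. emeasure N (A j) \<in> B j} \<in> sets point_algebra"
        using measurable_sets[OF count_meas[OF A(1)] B] by (simp add: vimage_def Int_def conj_commute)
    qed simp
    then have "measure ?P {N\<in>space ?P. \<forall>j<m. emeasure N (A j) \<in> B j}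
      = measure (poisson_sample r U) (scatter -` {N\<in>space point_algebra. \<forall>j<m. emeasure N (A j) \<in> B j} \<inter> space (poisson_sample r U))"
      by (subst measure_distr[OF sc]) (simp_all only: lessThan_iff Ball_def space_distr)
    also have "scatter -` {N\<in>space point_algebra. \<forall>j<m. emeasure N (A j) \<in> B j} \<inter> space (poisson_sample r U)
      = {\<omega>\<in>space (poisson_sample r U). \<forall>j<m. hits (A j) \<omega> \<in> {k. of_nat k \<in> B j}}"
      using A(1) by (auto simp: emeasure_scatter space_point_algebra scatter_in_point_measures)
    finally show ?thesis using hits_joint_law[OF U r A, where C = "\<lambda>j. {k. of_nat k \<in> B j}"] by simp
  qed
  have single: "measure ?P {N\<in>space ?P. emeasure N A \<in> B} = measure (poisson0_pmf (r * measure U A)) {k. of_nat k \<in> B}"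
    if "A \<in> sets borel" "B \<in> sets borel" for A B
    using joint[of 1 "\<lambda>_. A" "\<lambda>_. B"] that by (simp add: disjoint_family_on_def)
  show ?thesis
    unfolding poisson_process_law_def
  proof (intro conjI ballI allI impI)
    show "prob_space ?P" by (rule P.prob_space_axioms)
    show "sets ?P = sets point_algebra" by simp
    fix A :: "real set" and k :: nat assume A: "A \<in> sets borel"
    have "{i. (of_nat i :: ennreal) \<in> {of_nat k}} = {k}" by auto
    then show "measure ?P {N \<in> space ?P. emeasure N A = of_nat k}
      = exp (- measure (scale_measure (ennreal r) U) A) * measure (scale_measure (ennreal r) U) A ^ k / fact k"
      using single[OF A, of "{of_nat k}"] r by (simp add: mu measure_pmf_single pmf_poisson0)
  next
    fix m :: nat and A :: "nat \<Rightarrow> real set"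
    assume A: "A ` {..<m} \<subseteq> sets borel \<and> disjoint_family_on A {..<m}"
    show "P.indep_vars (\<lambda>_. borel) (\<lambda>i N. emeasure N (A i)) {..<m}"
    proof (rule P.indep_vars_lessThanI)
      fix i assume "i < m"
      then show "P.random_variable borel (\<lambda>N. emeasure N (A i))"
        using A count_meas[of "A i"] by (simp add: image_subset_iff)
    next
      fix B :: "nat \<Rightarrow> ennreal set" assume B: "\<And>i. i < m \<Longrightarrow> B i \<in> sets borel"
      show "measure ?P {N\<in>space ?P. \<forall>j<m. emeasure N (A j) \<in> B j}
          = (\<Prod>j<m. measure ?P {N\<in>space ?P. emeasure N (A j) \<in> B j})"
      proof (subst joint)
        show "(\<Prod>j<m. measure (poisson0_pmf (r * measure U (A j))) {k. of_nat k \<in> B j})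
            = (\<Prod>j<m. measure ?P {N\<in>space ?P. emeasure N (A j) \<in> B j})"
          using A B by (intro prod.cong refl single[symmetric]) auto
      qed (use A B in auto)
    qed
  qed
qed

section \<open>Conditioning a Poisson process on a void\<close>

definition void_event :: "real measure measure \<Rightarrow> real set \<Rightarrow> real measure set" where
  "void_event P A = {N\<in>space P. emeasure N A = 0}"

lemma space_poisson_process_law: "poisson_process_law \<mu> P \<Longrightarrow> space P = point_measures"
  unfolding poisson_process_law_def using sets_eq_imp_space_eq space_point_algebra by metis

lemma measurable_count_law:
  assumes "poisson_process_law \<mu> P" "A \<in> sets borel"
  shows "(\<lambda>N. emeasure N A) \<in> borel_measurable P"
proof -
  have "sets P = sets point_algebra" using assms(1) by (simp add: poisson_process_law_def)
  then show ?thesis using measurable_count[OF assms(2)] by (simp cong: measurable_cong_sets)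
qed

lemma void_event_sets: "poisson_process_law \<mu> P \<Longrightarrow> A \<in> sets borel \<Longrightarrow> void_event P A \<in> sets P"
  using measurable_sets[OF measurable_count_law, of \<mu> P A "{0}"]
  by (simp add: void_event_def vimage_def Int_def conj_commute)

lemma measure_void_event:
  assumes "poisson_process_law \<mu> P" "A \<in> sets borel" "emeasure \<mu> A < \<infinity>"
  shows "measure P (void_event P A) = exp (- measure \<mu> A)"
proof -
  have "measure P {N \<in> space P. emeasure N A = of_nat 0} = exp (- measure \<mu> A) * measure \<mu> A ^ 0 / fact 0"
    using assms unfolding poisson_process_law_def by blast
  then show ?thesis by (simp add: void_event_def)
qed

lemma emeasure_Diff_void:
  assumes "N \<in> point_measures" "emeasure N A = 0" "A \<in> sets borel" "B \<in> sets borel"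
  shows "emeasure N (B - A) = emeasure N B"
  using assms by (intro emeasure_Diff_null_set) (auto simp: point_measures_def null_sets_def)

text \<open>On the void event of \<open>A\<close> the count of \<open>B\<close> equals the count of \<open>B - A\<close>, and the latter is
  independent of that event. Conditioning therefore leaves the process outside \<open>A\<close> as it was and
  removes the points in \<open>A\<close>, that is, it restricts the mean measure to the complement of \<open>A\<close>.\<close>

theorem poisson_process_law_void:
  assumes law: "poisson_process_law \<mu> P" and mu: "sets \<mu> = sets borel"
    and A: "A \<in> sets borel" "emeasure \<mu> A < \<infinity>"
  shows "poisson_process_law (density \<mu> (indicator (- A))) (uniform_measure P (void_event P A))"
proof -
  interpret prob_space P using law by (simp add: poisson_process_law_def)
  let ?P = "uniform_measure P (void_event P A)"
  note Z = void_event_sets[OF law A(1)]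
  have q: "prob (void_event P A) = exp (- measure \<mu> A)" by (rule measure_void_event[OF law A])
  have q0: "emeasure P (void_event P A) \<noteq> 0" "emeasure P (void_event P A) \<noteq> \<infinity>"
    using q by (auto simp: emeasure_eq_measure)
  interpret Q: prob_space ?P by (rule prob_space_uniform_measure[OF q0])
  have joint: "measure ?P {N\<in>space P. \<forall>j<m. emeasure N (B j) \<in> C j}
      = (\<Prod>j<m. prob {N\<in>space P. emeasure N (B j - A) \<in> C j})"
    if B: "\<And>j. j < m \<Longrightarrow> B j \<in> sets borel" "disjoint_family_on B {..<m}"
      and C: "\<And>j. j < m \<Longrightarrow> C j \<in> sets borel" for m and B :: "nat \<Rightarrow> real set" and C :: "nat \<Rightarrow> ennreal set"
  proof -
    \<comment> \<open>\<open>A\<close> itself is adjoined as the last set, with the requirement that its count be zero\<close>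
    define B' where "B' j = (if j < m then B j - A else A)" for j
    define C' where "C' j = (if j < m then C j else {0})" for j
    have B'_meas: "B' j \<in> sets borel" if "j < Suc m" for j
      using B(1) A that by (auto simp: B'_def)
    have C'_meas: "C' j \<in> sets borel" if "j < Suc m" for j
      using C that by (auto simp: C'_def)
    have "disjoint_family_on B' {..<Suc m}"
      using B(2) unfolding disjoint_family_on_def B'_def by (auto simp: less_Suc_eq)
    moreover have "B' ` {..<Suc m} \<subseteq> sets borel" using B'_meas by blast
    ultimately have ind: "indep_vars (\<lambda>_. borel) (\<lambda>i N. emeasure N (B' i)) {..<Suc m}"
      using law unfolding poisson_process_law_def by blast
    have "prob (\<Inter>j\<in>{..<Suc m}. (\<lambda>N. emeasure N (B' j)) -` C' j \<inter> space P)
        = (\<Prod>j\<in>{..<Suc m}. prob ((\<lambda>N. emeasure N (B' j)) -` C' j \<inter> space P))"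
      by (rule indep_varsD_finite[OF ind]) (use C'_meas in auto)
    also have "\<dots> = (\<Prod>j<m. prob {N\<in>space P. emeasure N (B j - A) \<in> C j}) * prob (void_event P A)"
      by (simp add: B'_def C'_def void_event_def vimage_def Int_def conj_commute)
    also have "(\<Inter>j\<in>{..<Suc m}. (\<lambda>N. emeasure N (B' j)) -` C' j \<inter> space P)
        = {N\<in>space P. (\<forall>j<m. emeasure N (B j - A) \<in> C j) \<and> emeasure N A = 0}"
      by (auto simp: B'_def C'_def less_Suc_eq lessThan_Suc)
    also have "\<dots> = void_event P A \<inter> {N\<in>space P. \<forall>j<m. emeasure N (B j) \<in> C j}"
    proof -
      have "emeasure N (B j - A) = emeasure N (B j)" if "N \<in> space P" "emeasure N A = 0" "j < m" for N j
        using emeasure_Diff_void[OF _ that(2) A(1) B(1)[OF that(3)]] that(1)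
        by (simp add: space_poisson_process_law[OF law])
      then show ?thesis by (auto simp: void_event_def)
    qed
    finally have eq: "prob (void_event P A \<inter> {N\<in>space P. \<forall>j<m. emeasure N (B j) \<in> C j})
        = (\<Prod>j<m. prob {N\<in>space P. emeasure N (B j - A) \<in> C j}) * prob (void_event P A)" .
    have "{N\<in>space P. \<forall>j\<in>{..<m}. emeasure N (B j) \<in> C j} \<in> sets P"
    proof (rule sets.sets_Collect_finite_All)
      fix j assume "j \<in> {..<m}"
      then show "{N\<in>space P. emeasure N (B j) \<in> C j} \<in> sets P"
        using measurable_sets[OF measurable_count_law[OF law B(1)] C] by (simp add: vimage_def Int_def conj_commute)
    qed simp
    then have "{N\<in>space P. \<forall>j<m. emeasure N (B j) \<in> C j} \<in> sets P"
      by (simp only: lessThan_iff Ball_def)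
    with q0 have "measure ?P {N\<in>space P. \<forall>j<m. emeasure N (B j) \<in> C j}
        = prob (void_event P A \<inter> {N\<in>space P. \<forall>j<m. emeasure N (B j) \<in> C j}) / prob (void_event P A)"
      by (rule measure_uniform_measure)
    then show ?thesis using eq q by simp
  qed
  have single: "measure ?P {N\<in>space P. emeasure N B \<in> C} = prob {N\<in>space P. emeasure N (B - A) \<in> C}"
    if "B \<in> sets borel" "C \<in> sets borel" for B C
    using joint[of 1 "\<lambda>_. B" "\<lambda>_. C"] that by (simp add: disjoint_family_on_def)
  have dens: "emeasure (density \<mu> (indicator (- A))) B = emeasure \<mu> (B - A)" if "B \<in> sets borel" for B
  proof -
    have "emeasure (density \<mu> (indicator (- A))) B = (\<integral>\<^sup>+x. indicator (- A) x * indicator B x \<partial>\<mu>)"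
      using that A mu by (subst emeasure_density) auto
    also have "\<dots> = (\<integral>\<^sup>+x. indicator (B - A) x \<partial>\<mu>)"
      by (intro nn_integral_cong) (auto split: split_indicator)
    also have "\<dots> = emeasure \<mu> (B - A)"
      using that A mu by (intro nn_integral_indicator) auto
    finally show ?thesis .
  qed
  show ?thesis
    unfolding poisson_process_law_def
  proof (intro conjI ballI allI impI)
    show "prob_space ?P" by (rule Q.prob_space_axioms)
    show "sets ?P = sets point_algebra" using law by (simp add: poisson_process_law_def)
    fix B :: "real set" and k :: nat assume B: "B \<in> sets borel"
      and fin: "emeasure (density \<mu> (indicator (- A))) B < \<infinity>"
    have "prob {N \<in> space P. emeasure N (B - A) = of_nat k}
      = exp (- measure \<mu> (B - A)) * measure \<mu> (B - A) ^ k / fact k"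
      using law B A fin unfolding poisson_process_law_def dens[OF B] by blast
    then show "measure ?P {N \<in> space ?P. emeasure N B = of_nat k}
      = exp (- measure (density \<mu> (indicator (- A))) B) * measure (density \<mu> (indicator (- A))) B ^ k / fact k"
      using single[OF B, of "{of_nat k}"] by (simp add: measure_def dens[OF B])
  next
    fix m :: nat and B :: "nat \<Rightarrow> real set"
    assume B: "B ` {..<m} \<subseteq> sets borel \<and> disjoint_family_on B {..<m}"
    show "Q.indep_vars (\<lambda>_. borel) (\<lambda>i N. emeasure N (B i)) {..<m}"
    proof (rule Q.indep_vars_lessThanI)
      fix i assume "i < m"
      then show "Q.random_variable borel (\<lambda>N. emeasure N (B i))"
        using B measurable_count_law[OF law, of "B i"] by (simp add: image_subset_iff)
    next
      fix C :: "nat \<Rightarrow> ennreal set" assume C: "\<And>i. i < m \<Longrightarrow> C i \<in> sets borel"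
      have "measure ?P {N\<in>space P. \<forall>j<m. emeasure N (B j) \<in> C j}
          = (\<Prod>j<m. prob {N\<in>space P. emeasure N (B j - A) \<in> C j})"
        by (rule joint) (use B C in auto)
      also have "\<dots> = (\<Prod>j<m. measure ?P {N\<in>space P. emeasure N (B j) \<in> C j})"
        using B C by (intro prod.cong refl single[symmetric]) auto
      finally show "measure ?P {N\<in>space ?P. \<forall>j<m. emeasure N (B j) \<in> C j}
          = (\<Prod>j<m. measure ?P {N\<in>space ?P. emeasure N (B j) \<in> C j})" by simp
    qed
  qed
qed

section \<open>Haar coefficients of dyadic cells\<close>

declare haar.simps [simp del]

definition cell :: "nat \<Rightarrow> nat \<Rightarrow> real set" where
  "cell J p = {real p / 2 ^ J ..< (real p + 1) / 2 ^ J}"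

lemma cell_borel [simp, measurable]: "cell J p \<in> sets borel"
  by (simp add: cell_def)

lemma cell_iff_floor: "x \<in> cell J p \<longleftrightarrow> nat \<lfloor>2 ^ J * x\<rfloor> = p \<and> 0 \<le> x"
proof -
  have "x \<in> cell J p \<longleftrightarrow> real p \<le> 2 ^ J * x \<and> 2 ^ J * x < real p + 1"
    by (simp add: cell_def field_simps)
  also have "\<dots> \<longleftrightarrow> \<lfloor>2 ^ J * x\<rfloor> = int p"
    by (subst floor_eq_iff) auto
  also have "\<dots> \<longleftrightarrow> nat \<lfloor>2 ^ J * x\<rfloor> = p \<and> 0 \<le> x"
  proof -
    have "0 \<le> \<lfloor>2 ^ J * x\<rfloor> \<longleftrightarrow> 0 \<le> x" using mult_le_cancel_left_pos[of "2 ^ J" 0 x] by simp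
    then show ?thesis by (metis nat_0_le nat_int of_nat_0_le_iff)
  qed
  finally show ?thesis .
qed

lemma disjoint_cell: "p \<noteq> p' \<Longrightarrow> cell J p \<inter> cell J p' = {}"
  by (auto simp: cell_iff_floor)

lemma cell_subset:
  assumes "I \<le> J"
  shows "cell J p \<subseteq> cell I (p div 2 ^ (J - I))"
proof
  fix x assume x: "x \<in> cell J p"
  define d where "d = p div 2 ^ (J - I)"
  have "d * 2 ^ (J - I) \<le> p"
    unfolding d_def by (rule div_times_less_eq_dividend)
  then have "real (d * 2 ^ (J - I)) \<le> real p"
    by (rule of_nat_mono)
  then have "real d * 2 ^ (J - I) \<le> real p" by simp
  moreover have "p < 2 ^ (J - I) + d * 2 ^ (J - I)"
    unfolding d_def by (rule dividend_less_div_times) simp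
  then have "real (p + 1) \<le> real (2 ^ (J - I) + d * 2 ^ (J - I))"
    by (intro of_nat_mono) simp
  then have "real p + 1 \<le> (real d + 1) * 2 ^ (J - I)" by (simp add: algebra_simps)
  moreover have "(2::real) ^ J = 2 ^ (J - I) * 2 ^ I" using assms by (simp flip: power_add)
  ultimately have "real d / 2 ^ I \<le> real p / 2 ^ J" "(real p + 1) / 2 ^ J \<le> (real d + 1) / 2 ^ I"
    using divide_right_mono[of "real d * 2 ^ (J - I)" "real p" "2 ^ J"]
      divide_right_mono[of "real p + 1" "(real d + 1) * 2 ^ (J - I)" "2 ^ J"] by simp_all
  then show "x \<in> cell I (p div 2 ^ (J - I))"
    using x unfolding d_def[symmetric] cell_def by auto
qed

lemma measure_cell: "measure lborel (cell J p) = 1 / 2 ^ J" "emeasure lborel (cell J p) = ennreal (1 / 2 ^ J)"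
proof -
  have "real p / 2 ^ J \<le> (real p + 1) / 2 ^ J" by (simp add: divide_right_mono)
  moreover have "(real p + 1) / 2 ^ J - real p / 2 ^ J = 1 / 2 ^ J" by (simp add: diff_divide_distrib[symmetric])
  ultimately show "measure lborel (cell J p) = 1 / 2 ^ J" "emeasure lborel (cell J p) = ennreal (1 / 2 ^ J)"
    by (simp_all add: cell_def)
qed

text \<open>A number strictly between two consecutive integers compares with every integer in the same way as
  the lower of the two.\<close>

lemma int_thresholds:
  fixes K :: int and p :: nat and z :: real
  assumes "real p < z" "z < real p + 1"
  shows "of_int K \<le> z \<longleftrightarrow> K \<le> int p" "z \<le> of_int K \<longleftrightarrow> int p < K"
proof -
  have "\<lfloor>z\<rfloor> = int p" using assms by (simp add: floor_eq_iff)
  then show 1: "of_int K \<le> z \<longleftrightarrow> K \<le> int p" by (metis le_floor_iff)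
  show "z \<le> of_int K \<longleftrightarrow> int p < K"
  proof
    assume "z \<le> of_int K"
    then have "real p < of_int K" using assms by linarith
    then show "int p < K" by linarith
  next
    assume "int p < K"
    then have "real p + 1 \<le> of_int K" by linarith
    then show "z \<le> of_int K" using assms by linarith
  qed
qed

lemma haar_nat: "haar (int j, k) x = 2 powr (real j / 2) * haar_psi (2 ^ j * x - of_int k)"
  by (simp add: haar.simps powr_realpow)

lemma haar_psi_eq:
  "haar_psi y = (if 0 \<le> y \<and> y \<le> 1 / 2 then 1 else if 1 / 2 < y \<and> y \<le> 1 then -1 else 0)"
  by (auto simp: haar_psi_def indicator_def)

text \<open>The breakpoints of a wavelet of level \<open>j < J\<close> are multiples of \<open>2^(-J)\<close>, so the wavelet is constant
  in the interior of every cell of level \<open>J\<close>. It is nonzero there iff the ancestor of the cell at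
  level \<open>j\<close> is its support, and the sign is given by the parity of the ancestor at level \<open>j + 1\<close>.\<close>

lemma haar_on_cell:
  assumes "j < J" "real p < 2 ^ J * x" "2 ^ J * x < real p + 1"
  shows "haar (int j, k) x = (if k = int (p div 2 ^ (J - j))
    then (if p div 2 ^ (J - Suc j) mod 2 = 0 then 2 powr (real j / 2) else - (2 powr (real j / 2))) else 0)"
proof -
  define d where "d = J - Suc j"
  have J: "J = j + Suc d" using assms(1) by (simp add: d_def)
  define z where "z = 2 ^ J * x"
  have z: "real p < z" "z < real p + 1" using assms by (auto simp: z_def)
  \<comment> \<open>the ancestor of the cell at level \<open>j + 1\<close>, that is, a half of the support of a wavelet of level \<open>j\<close>\<close>
  define q where "q = p div 2 ^ d"
  have y: "2 ^ j * x = z / 2 ^ Suc d" by (simp add: z_def J power_add)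
  have le: "K * 2 ^ d \<le> int p \<longleftrightarrow> K \<le> int q" for K :: int
  proof -
    have q: "int q = int p div 2 ^ d" by (simp add: q_def zdiv_int)
    have "K * 2 ^ d \<le> int p \<Longrightarrow> K \<le> int q"
      using zdiv_mono1[of "K * 2 ^ d" "int p" "2 ^ d"] by (simp add: q)
    moreover have "K * 2 ^ d \<le> int p" if "K \<le> int q"
    proof -
      have "K * 2 ^ d \<le> int q * 2 ^ d" using that by (simp add: mult_right_mono)
      also have "\<dots> \<le> int p"
      proof -
        have "0 \<le> int p mod 2 ^ d" by simp
        then show ?thesis unfolding q using minus_mod_eq_div_mult[of "int p" "2 ^ d"] by linarith
      qed
      finally show ?thesis .
    qed
    ultimately show ?thesis by blast
  qed
  have lt: "int p < K * 2 ^ d \<longleftrightarrow> int q < K" for K :: int using le[of K] by linarith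
  have gen: "0 \<le> w - c \<longleftrightarrow> c \<le> w" "w - c \<le> 1 / 2 \<longleftrightarrow> w \<le> c + 1 / 2" "w - c \<le> 1 \<longleftrightarrow> w \<le> c + 1"
    for w c :: real by (auto simp: diff_le_eq add.commute)
  have 1: "0 \<le> 2 ^ j * x - of_int k \<longleftrightarrow> 2 * k \<le> int q"
  proof -
    have "0 \<le> 2 ^ j * x - of_int k \<longleftrightarrow> of_int k \<le> z / 2 ^ Suc d"
      unfolding y by (rule gen)
    also have "\<dots> \<longleftrightarrow> of_int (2 * k * 2 ^ d) \<le> z" by (simp add: field_simps)
    also have "\<dots> \<longleftrightarrow> 2 * k * 2 ^ d \<le> int p" by (rule int_thresholds(1)[OF z])
    also have "\<dots> \<longleftrightarrow> 2 * k \<le> int q" by (rule le)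
    finally show ?thesis .
  qed
  have 2: "2 ^ j * x - of_int k \<le> 1 / 2 \<longleftrightarrow> int q < 2 * k + 1"
  proof -
    have "2 ^ j * x - of_int k \<le> 1 / 2 \<longleftrightarrow> z / 2 ^ Suc d \<le> of_int k + 1 / 2"
      unfolding y by (rule gen)
    also have "\<dots> \<longleftrightarrow> z \<le> of_int ((2 * k + 1) * 2 ^ d)" by (simp add: field_simps)
    also have "\<dots> \<longleftrightarrow> int p < (2 * k + 1) * 2 ^ d" by (rule int_thresholds(2)[OF z])
    also have "\<dots> \<longleftrightarrow> int q < 2 * k + 1" by (rule lt)
    finally show ?thesis .
  qed
  have 3: "2 ^ j * x - of_int k \<le> 1 \<longleftrightarrow> int q < 2 * k + 2"
  proof -
    have "2 ^ j * x - of_int k \<le> 1 \<longleftrightarrow> z / 2 ^ Suc d \<le> of_int k + 1"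
      unfolding y by (rule gen)
    also have "\<dots> \<longleftrightarrow> z \<le> of_int ((2 * k + 2) * 2 ^ d)" by (simp add: field_simps)
    also have "\<dots> \<longleftrightarrow> int p < (2 * k + 2) * 2 ^ d" by (rule int_thresholds(2)[OF z])
    also have "\<dots> \<longleftrightarrow> int q < 2 * k + 2" by (rule lt)
    finally show ?thesis .
  qed
  have q2: "p div 2 ^ (J - j) = q div 2"
    by (simp add: q_def J div_mult2_eq[symmetric] mult.commute)
  have q3: "p div 2 ^ (J - Suc j) = q" by (simp add: q_def d_def)
  define y where "y = 2 ^ j * x - of_int k"
  have up: "0 \<le> y \<and> y \<le> 1 / 2 \<longleftrightarrow> int q = 2 * k"
    unfolding y_def using 1 2 by linarith
  have down: "1 / 2 < y \<and> y \<le> 1 \<longleftrightarrow> int q = 2 * k + 1"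
    unfolding y_def using 2 3 by linarith
  have parity: "k = int (q div 2) \<longleftrightarrow> int q = 2 * k \<or> int q = 2 * k + 1"
    "int q = 2 * k \<Longrightarrow> q mod 2 = 0" "int q = 2 * k + 1 \<Longrightarrow> q mod 2 \<noteq> 0"
    by presburger+
  show ?thesis
    unfolding haar_nat haar_psi_eq q2 q3 y_def[symmetric] up down parity(1)
    using parity(2,3) by auto
qed

lemma haar_indicator:
  "haar (int j, k) x = 2 powr (real j / 2) *
     (indicator {of_int k / 2 ^ j..(of_int k + 1 / 2) / 2 ^ j} x
      - indicator {(of_int k + 1 / 2) / 2 ^ j<..(of_int k + 1) / 2 ^ j} x)"
  unfolding haar_nat haar_psi_eq by (auto simp: indicator_def field_simps)

lemma haar_square:
  "(haar (int j, k) x)\<^sup>2 = 2 ^ j * indicator {of_int k / 2 ^ j..(of_int k + 1) / 2 ^ j} x"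
proof -
  have "(2 powr (real j / 2))\<^sup>2 = (2 :: real) ^ j"
    by (simp add: power2_eq_square powr_add[symmetric] powr_realpow)
  moreover have "(haar_psi (2 ^ j * x - of_int k))\<^sup>2 = indicator {of_int k / 2 ^ j..(of_int k + 1) / 2 ^ j} x"
    unfolding haar_psi_eq by (auto simp: indicator_def field_simps)
  ultimately show ?thesis unfolding haar_nat power_mult_distrib by simp
qed

lemma haar_father: "haar (-1, k) x = indicator {of_int k..of_int k + 1} x"
  by (auto simp: haar.simps haar_phi_def indicator_def)

lemma haar_measurable [measurable]: "l \<in> Lam \<Longrightarrow> haar l \<in> borel_measurable borel"
proof -
  assume "l \<in> Lam"
  then obtain j k where l: "l = (j, k)" "-1 \<le> j" by (auto simp: Lam_def)
  show "haar l \<in> borel_measurable borel"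
  proof (cases "j = -1")
    case True
    then have "haar l = indicator {of_int k..of_int k + 1}" by (auto simp: l fun_eq_iff haar_father)
    then show ?thesis by simp
  next
    case False
    then obtain i where i: "j = int i" using l(2) by (metis nat_0_le linorder_not_le order_le_less zle_add1_eq_le add.left_inverse)
    show ?thesis unfolding l(1) i haar_indicator[abs_def] by measurable
  qed
qed

lemma haar_bounded: "l \<in> Lam \<Longrightarrow> \<exists>c. \<forall>x. \<bar>haar l x\<bar> \<le> c"
proof -
  assume "l \<in> Lam"
  then obtain j k where l: "l = (j, k)" by (auto simp: Lam_def)
  have "\<bar>haar l x\<bar> \<le> max 1 (2 powr (of_int j / 2))" for x
    by (auto simp: l haar.simps haar_phi_def haar_psi_eq abs_mult indicator_def)
  then show ?thesis by blast
qed

lemma integrable_haar_indicator: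
  assumes "l \<in> Lam" "S \<in> sets borel" "emeasure lborel S < \<infinity>"
  shows "integrable lborel (\<lambda>x. haar l x * indicator S x)"
proof -
  obtain c where c: "\<And>x. \<bar>haar l x\<bar> \<le> c" using haar_bounded[OF assms(1)] by blast
  have "integrable lborel (\<lambda>x. indicator S x *\<^sub>R haar l x)"
    by (rule integrableI_bounded_set_indicator[where B = c])
       (use assms c haar_measurable[OF assms(1)] in auto)
  then show ?thesis by (simp add: mult.commute)
qed

lemma coef_cell_coarse:
  assumes "j < J"
  shows "coef (indicator (cell J p)) (int j, k) = (if k = int (p div 2 ^ (J - j))
    then (if p div 2 ^ (J - Suc j) mod 2 = 0 then 2 powr (real j / 2) else - (2 powr (real j / 2))) else 0) / 2 ^ J"
proof -
  define c where "c = (if k = int (p div 2 ^ (J - j))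
    then (if p div 2 ^ (J - Suc j) mod 2 = 0 then 2 powr (real j / 2) else - (2 powr (real j / 2))) else 0)"
  have lam: "(int j, k) \<in> Lam" by (simp add: Lam_def)
  have "AE x in lborel. x \<noteq> real p / 2 ^ J" by (rule AE_lborel_singleton)
  then have "AE x in lborel. haar (int j, k) x * indicator (cell J p) x = c * indicator (cell J p) x"
  proof eventually_elim
    case (elim x)
    show ?case
    proof (cases "x \<in> cell J p")
      case True
      then have "real p < 2 ^ J * x" "2 ^ J * x < real p + 1"
        using elim by (auto simp: cell_def field_simps)
      then have "haar (int j, k) x = c" unfolding c_def by (rule haar_on_cell[OF assms])
      then show ?thesis by (simp only:)
    qed simp
  qed
  then have "coef (indicator (cell J p)) (int j, k) = (\<integral>x. c * indicator (cell J p) x \<partial>lborel)"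
    unfolding coef_def using haar_measurable[OF lam] by (intro integral_cong_AE) auto
  also have "\<dots> = c * (1 / 2 ^ J)" by (simp add: measure_cell)
  finally show ?thesis by (simp add: c_def)
qed

lemma integral_haar: "(\<integral>x. haar (int j, k) x \<partial>lborel) = 0"
proof -
  have step: "(\<integral>x. c * (indicator {u..v} x - indicator {v<..w} x) \<partial>lborel) = c * ((v - u) - (w - v))"
    if "u \<le> v" "v \<le> w" for c u v w :: real
    using that by (simp add: Bochner_Integration.integral_diff)
  have "of_int k / 2 ^ j \<le> (of_int k + 1 / 2) / (2 :: real) ^ j" "(of_int k + 1 / 2) / 2 ^ j \<le> (of_int k + 1) / (2 :: real) ^ j"
    by (simp_all add: divide_right_mono)
  then show ?thesis
    unfolding haar_indicator by (subst step) (simp_all add: diff_divide_distrib[symmetric])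
qed

text \<open>Up to its end points, the support of a wavelet at least as fine as the cell is either disjoint from
  the cell or contained in it; in the second case the coefficient is the integral of the wavelet,
  which vanishes.\<close>

lemma coef_cell_fine:
  assumes "J \<le> j"
  shows "coef (indicator (cell J p)) (int j, k) = 0"
proof -
  have lam: "(int j, k) \<in> Lam" by (simp add: Lam_def)
  define d where "d = j - J"
  have j: "(2::real) ^ j = 2 ^ J * 2 ^ d" using assms by (simp add: d_def power_add[symmetric])
  have zero: "haar (int j, k) x = 0" if "2 ^ j * x < of_int k \<or> of_int k + 1 < 2 ^ j * x" for x
    using that unfolding haar_nat haar_psi_eq by auto
  have AE: "AE x in lborel. x \<noteq> real p / 2 ^ J \<and> x \<noteq> (real p + 1) / 2 ^ J"
    using AE_lborel_singleton[of "real p / 2 ^ J"] AE_lborel_singleton[of "(real p + 1) / 2 ^ J"] by eventually_elim auto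
  have cellD: "real p * 2 ^ d \<le> 2 ^ j * x \<and> 2 ^ j * x < (real p + 1) * 2 ^ d \<longleftrightarrow> x \<in> cell J p" for x
  proof -
    have eq: "2 ^ j * x = (2 ^ J * x) * 2 ^ d" by (simp add: j)
    have "real p * 2 ^ d \<le> 2 ^ j * x \<and> 2 ^ j * x < (real p + 1) * 2 ^ d
        \<longleftrightarrow> real p \<le> 2 ^ J * x \<and> 2 ^ J * x < real p + 1" unfolding eq by simp
    then show ?thesis by (simp add: cell_def field_simps)
  qed
  have neq: "2 ^ j * x \<noteq> real p * 2 ^ d" "2 ^ j * x \<noteq> (real p + 1) * 2 ^ d" if "x \<noteq> real p / 2 ^ J \<and> x \<noteq> (real p + 1) / 2 ^ J" for x
  proof -
    have eq: "2 ^ j * x = (2 ^ J * x) * 2 ^ d" by (simp add: j)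
    have "2 ^ J * x \<noteq> real p" "2 ^ J * x \<noteq> real p + 1" using that by (auto simp: field_simps)
    then show "2 ^ j * x \<noteq> real p * 2 ^ d" "2 ^ j * x \<noteq> (real p + 1) * 2 ^ d" unfolding eq by simp_all
  qed
  consider "k + 1 \<le> int p * 2 ^ d" | "(int p + 1) * 2 ^ d \<le> k" | "int p * 2 ^ d \<le> k" "k + 1 \<le> (int p + 1) * 2 ^ d"
    by linarith
  then have "(AE x in lborel. haar (int j, k) x * indicator (cell J p) x = 0)
    \<or> (AE x in lborel. haar (int j, k) x * indicator (cell J p) x = haar (int j, k) x)"
  proof cases
    case 1
    then have "real_of_int (k + 1) \<le> of_int (int p * 2 ^ d)" by (simp only: of_int_le_iff)
    then have k: "of_int k + 1 \<le> real p * 2 ^ d" by simp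
    from AE have "AE x in lborel. haar (int j, k) x * indicator (cell J p) x = 0"
    proof eventually_elim
      case (elim x)
      show ?case
      proof (cases "x \<in> cell J p")
        case True
        then have "haar (int j, k) x = 0" using neq[OF elim] k cellD[of x] by (intro zero) linarith
        then show ?thesis by (simp only: mult_zero_left)
      qed simp
    qed
    then show ?thesis by blast
  next
    case 2
    then have "real_of_int ((int p + 1) * 2 ^ d) \<le> of_int k" by (simp only: of_int_le_iff)
    then have k: "(real p + 1) * 2 ^ d \<le> of_int k" by simp
    from AE have "AE x in lborel. haar (int j, k) x * indicator (cell J p) x = 0"
    proof eventually_elim
      case (elim x)
      show ?case
      proof (cases "x \<in> cell J p")
        case True
        then have "haar (int j, k) x = 0" using k cellD[of x] by (intro zero) linarith
        then show ?thesis by (simp only: mult_zero_left)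
      qed simp
    qed
    then show ?thesis by blast
  next
    case 3
    then have "real_of_int (k + 1) \<le> of_int ((int p + 1) * 2 ^ d)" "real_of_int (int p * 2 ^ d) \<le> of_int k"
      by (simp_all only: of_int_le_iff)
    then have k: "of_int k + 1 \<le> (real p + 1) * 2 ^ d" "real p * 2 ^ d \<le> of_int k" by simp_all
    from AE have "AE x in lborel. haar (int j, k) x * indicator (cell J p) x = haar (int j, k) x"
    proof eventually_elim
      case (elim x)
      show ?case
      proof (cases "x \<in> cell J p")
        case False
        then have "haar (int j, k) x = 0" using neq[OF elim] k cellD[of x] by (intro zero) linarith
        then show ?thesis by (simp only: mult_zero_left)
      qed simp
    qed
    then show ?thesis by blast
  qed
  then show ?thesis
  proof
    assume "AE x in lborel. haar (int j, k) x * indicator (cell J p) x = 0"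
    then show ?thesis unfolding coef_def by (rule integral_eq_zero_AE)
  next
    assume "AE x in lborel. haar (int j, k) x * indicator (cell J p) x = haar (int j, k) x"
    then have "coef (indicator (cell J p)) (int j, k) = (\<integral>x. haar (int j, k) x \<partial>lborel)"
      unfolding coef_def using haar_measurable[OF lam] by (intro integral_cong_AE) simp_all
    then show ?thesis by (simp only: integral_haar)
  qed
qed

section \<open>Haar coefficients of the carved unit interval\<close>

text \<open>Here \<open>p b\<close> is the number, among the cells of level \<open>J\<close>, of the cell removed from the block
  \<open>cell I b\<close>; it lies in that block iff \<open>p b div 2 ^ (J - I) = b\<close>.\<close>

definition carved :: "nat \<Rightarrow> nat \<Rightarrow> (nat \<Rightarrow> nat) \<Rightarrow> real set" where
  "carved I J p = cell 0 0 - (\<Union>b<2 ^ I. cell J (p b))"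

lemma carved_borel [simp, measurable]: "carved I J p \<in> sets borel"
  unfolding carved_def by (rule sets.Diff[OF cell_borel sets.finite_UN]) simp_all

lemma cell_unit: "cell 0 0 = {0..<1}"
  by (simp add: cell_def)

context
  fixes I J :: nat and p :: "nat \<Rightarrow> nat"
  assumes IJ: "I \<le> J" and p: "\<And>b. b < 2 ^ I \<Longrightarrow> p b div 2 ^ (J - I) = b"
begin

text \<open>At levels not finer than the blocks the ancestors of a hole depend on its block only.\<close>

lemma div_scale:
  assumes "j \<le> I" "b < 2 ^ I"
  shows "p b div 2 ^ (J - j) = b div 2 ^ (I - j)"
proof -
  have "J - j = (J - I) + (I - j)" using assms IJ by simp
  then have "p b div 2 ^ (J - j) = p b div (2 ^ (J - I) * 2 ^ (I - j))" by (simp only: power_add)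
  then show ?thesis by (simp only: div_mult2_eq p[OF assms(2)])
qed

lemma block_cell_subset: "b < 2 ^ I \<Longrightarrow> cell J (p b) \<subseteq> cell I b"
  using cell_subset[OF IJ, of "p b"] p by simp

lemma block_subset_unit: "b < 2 ^ I \<Longrightarrow> cell I b \<subseteq> cell 0 0"
  using cell_subset[of 0 I b] by simp

lemma disjoint_holes: "disjoint_family_on (\<lambda>b. cell J (p b)) {..<2 ^ I}"
  unfolding disjoint_family_on_def using block_cell_subset disjoint_cell by blast

lemma indicator_carved:
  "indicator (carved I J p) x = indicator (cell 0 0) x - (\<Sum>b<2 ^ I. indicator (cell J (p b)) x :: real)"
proof -
  have "(\<Union>b<2 ^ I. cell J (p b)) \<subseteq> cell 0 0"
    using block_cell_subset block_subset_unit by blast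
  then have "indicator (carved I J p) x = indicator (cell 0 0) x - (indicator (\<Union>b<2 ^ I. cell J (p b)) x :: real)"
    unfolding carved_def by (auto split: split_indicator)
  then show ?thesis using indicator_UN_disjoint[OF _ disjoint_holes, of x] by simp
qed

lemma coef_carved:
  assumes "l \<in> Lam"
  shows "coef (indicator (carved I J p)) l
    = coef (indicator (cell 0 0)) l - (\<Sum>b<2 ^ I. coef (indicator (cell J (p b))) l)"
proof -
  have int: "integrable lborel (\<lambda>x. haar l x * indicator (cell i q) x)" for i q
    by (rule integrable_haar_indicator[OF assms]) (auto simp: measure_cell)
  have "coef (indicator (carved I J p)) l
    = (\<integral>x. haar l x * indicator (cell 0 0) x - (\<Sum>b<2 ^ I. haar l x * indicator (cell J (p b)) x) \<partial>lborel)"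
    unfolding coef_def indicator_carved by (simp only: right_diff_distrib sum_distrib_left)
  also have "\<dots> = (\<integral>x. haar l x * indicator (cell 0 0) x \<partial>lborel) - (\<Sum>b<2 ^ I. (\<integral>x. haar l x * indicator (cell J (p b)) x \<partial>lborel))"
    by (subst Bochner_Integration.integral_diff[OF int Bochner_Integration.integrable_sum[OF int]],
        subst Bochner_Integration.integral_sum[OF int]) (rule refl)
  finally show ?thesis by (simp only: coef_def)
qed

lemma coef_carved_wavelet:
  "coef (indicator (carved I J p)) (int j, k) = - (\<Sum>b<2 ^ I. coef (indicator (cell J (p b))) (int j, k))"
  using coef_carved[of "(int j, k)"] coef_cell_fine[of 0 j 0 k] by (simp add: Lam_def)

lemma coef_carved_fine: "J \<le> j \<Longrightarrow> coef (indicator (carved I J p)) (int j, k) = 0"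
  using coef_cell_fine by (simp add: coef_carved_wavelet)

text \<open>A coarse wavelet does not see where in its block a hole lies: it sees each hole as a block,
  scaled down by the same factor. Together the blocks make up the unit interval, which is
  orthogonal to every wavelet.\<close>

lemma coef_carved_coarse:
  assumes "j < I"
  shows "coef (indicator (carved I J p)) (int j, k) = 0"
proof -
  have lam: "(int j, k) \<in> Lam" by (simp add: Lam_def)
  have int: "integrable lborel (\<lambda>x. haar (int j, k) x * indicator (cell i q) x)" for i q
    by (rule integrable_haar_indicator[OF lam]) (auto simp: measure_cell)
  have scale: "coef (indicator (cell J (p b))) (int j, k) = 2 ^ I / 2 ^ J * coef (indicator (cell I b)) (int j, k)"
    if "b < 2 ^ I" for b
  proof -
    have "p b div 2 ^ (J - j) = b div 2 ^ (I - j)" "p b div 2 ^ (J - Suc j) = b div 2 ^ (I - Suc j)"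
      using assms that by (auto intro: div_scale)
    then show ?thesis
      using coef_cell_coarse[of j J "p b" k] coef_cell_coarse[of j I b k] assms IJ by simp
  qed
  have unit: "indicator (cell 0 0) x = (\<Sum>b<2 ^ I. indicator (cell I b) x :: real)" for x
  proof -
    have "cell 0 0 = (\<Union>b<2 ^ I. cell I b)"
    proof
      show "(\<Union>b<2 ^ I. cell I b) \<subseteq> cell 0 0" using block_subset_unit by blast
      show "cell 0 0 \<subseteq> (\<Union>b<2 ^ I. cell I b)"
      proof
        fix x :: real assume "x \<in> cell 0 0"
        then have x: "0 \<le> x" "x < 1" by (auto simp: cell_unit)
        then have "2 ^ I * x < 2 ^ I" by simp
        then have "\<lfloor>2 ^ I * x\<rfloor> < 2 ^ I" by (simp add: floor_less_iff)
        then have "nat \<lfloor>2 ^ I * x\<rfloor> < 2 ^ I" using x by (subst nat_less_iff) auto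
        moreover have "x \<in> cell I (nat \<lfloor>2 ^ I * x\<rfloor>)" using x by (simp add: cell_iff_floor)
        ultimately show "x \<in> (\<Union>b<2 ^ I. cell I b)" by blast
      qed
    qed
    moreover have "disjoint_family_on (cell I) {..<2 ^ I}"
      unfolding disjoint_family_on_def using disjoint_cell by blast
    ultimately show ?thesis using indicator_UN_disjoint[of "{..<2 ^ I}" "cell I" x] by simp
  qed
  have "(\<Sum>b<2 ^ I. coef (indicator (cell I b)) (int j, k)) = coef (indicator (cell 0 0)) (int j, k)"
    unfolding coef_def unit sum_distrib_left using int by (intro Bochner_Integration.integral_sum[symmetric]) auto
  also have "\<dots> = 0" by (rule coef_cell_fine) simp
  finally have unscaled: "(\<Sum>b<2 ^ I. coef (indicator (cell I b)) (int j, k)) = 0" .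
  have "(\<Sum>b<2 ^ I. coef (indicator (cell J (p b))) (int j, k))
      = (\<Sum>b<2 ^ I. 2 ^ I / 2 ^ J * coef (indicator (cell I b)) (int j, k))"
    by (intro sum.cong refl scale) simp
  also have "\<dots> = 2 ^ I / 2 ^ J * (\<Sum>b<2 ^ I. coef (indicator (cell I b)) (int j, k))"
    by (rule sum_distrib_left[symmetric])
  finally show ?thesis unfolding coef_carved_wavelet unscaled by simp
qed

text \<open>At levels between the blocks and the cells, the support of a wavelet lies in one block and
  contains at most the one hole of that block.\<close>

lemma coef_carved_middle:
  assumes "I \<le> j" "j < J"
  shows "b < 2 ^ I \<Longrightarrow> \<bar>coef (indicator (carved I J p)) (int j, int (p b div 2 ^ (J - j)))\<bar> = 2 powr (real j / 2) / 2 ^ J"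
    and "k \<notin> (\<lambda>b. int (p b div 2 ^ (J - j))) ` {..<2 ^ I} \<Longrightarrow> coef (indicator (carved I J p)) (int j, k) = 0"
proof -
  assume b: "b < 2 ^ I"
  have "p b div 2 ^ (J - j) \<noteq> p b' div 2 ^ (J - j)" if "b' < 2 ^ I" "b' \<noteq> b" for b'
  proof
    assume eq: "p b div 2 ^ (J - j) = p b' div 2 ^ (J - j)"
    have J: "J - I = (J - j) + (j - I)" using assms by simp
    have "p b div 2 ^ (J - I) = p b' div 2 ^ (J - I)"
      unfolding J power_add div_mult2_eq eq by (rule refl)
    then show False using p b that by simp
  qed
  then have "(\<Sum>b'<2 ^ I. coef (indicator (cell J (p b'))) (int j, int (p b div 2 ^ (J - j))))
    = (\<Sum>b'\<in>{b}. coef (indicator (cell J (p b'))) (int j, int (p b div 2 ^ (J - j))))"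
    using b assms by (intro sum.mono_neutral_right) (auto simp: coef_cell_coarse)
  then show "\<bar>coef (indicator (carved I J p)) (int j, int (p b div 2 ^ (J - j)))\<bar> = 2 powr (real j / 2) / 2 ^ J"
    using assms by (simp add: coef_carved_wavelet coef_cell_coarse)
next
  assume "k \<notin> (\<lambda>b. int (p b div 2 ^ (J - j))) ` {..<2 ^ I}"
  then show "coef (indicator (carved I J p)) (int j, k) = 0"
    using assms by (auto simp: coef_carved_wavelet coef_cell_coarse intro!: sum.neutral)
qed

lemma coef_cell_father:
  assumes "b < 2 ^ i"
  shows "coef (indicator (cell i b)) (-1, k) = (if k = 0 then 1 / 2 ^ i else 0)"
proof -
  have sub: "cell i b \<subseteq> {0..<1}" using cell_subset[of 0 i b] assms by (simp add: cell_unit)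
  show ?thesis
  proof (cases "k = 0")
    case True
    have "haar (-1, k) x * indicator (cell i b) x = indicator (cell i b) x" for x
      unfolding haar_father using sub True by (auto split: split_indicator)
    then show ?thesis using True by (simp only: coef_def) (simp add: measure_cell)
  next
    case False
    then have k: "1 \<le> k \<or> k + 1 \<le> 0" by linarith
    have "AE x in lborel. x \<noteq> (0 :: real)" by (rule AE_lborel_singleton)
    then have "AE x in lborel. haar (-1, k) x * indicator (cell i b) x = 0"
    proof eventually_elim
      case (elim x)
      have "\<not> (of_int k \<le> x \<and> x \<le> of_int k + 1)" if "x \<in> cell i b"
      proof -
        have "0 < x" "x < 1" using sub that elim by (auto simp: subset_eq less_le)
        then show ?thesis using k by (auto dest: of_int_le_iff[where ?'a = real, THEN iffD2])
      qed
      then show ?case unfolding haar_father by (auto split: split_indicator)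
    qed
    then show ?thesis using False unfolding coef_def by (simp add: integral_eq_zero_AE)
  qed
qed

lemma coef_carved_father: "coef (indicator (carved I J p)) (-1, k) = (if k = 0 then 1 - 2 ^ I / 2 ^ J else 0)"
proof -
  have "p b < 2 ^ J" if "b < 2 ^ I" for b
  proof -
    have "p b div 2 ^ J = 0" using div_scale[of 0 b] that by simp
    then show ?thesis by (simp add: div_eq_0_iff)
  qed
  then show ?thesis
    using coef_carved[of "(-1, k)"] coef_cell_father[of 0 0 k] by (simp add: Lam_def coef_cell_father)
qed

lemma sigma_carved_le: "sigma_coef (indicator (carved I J p)) (int j, k) \<le> 1"
proof -
  have "(\<integral>x. (haar (int j, k) x)\<^sup>2 * indicator (carved I J p) x \<partial>lborel)
      \<le> (\<integral>x. 2 ^ j * indicator {of_int k / 2 ^ j..(of_int k + 1) / 2 ^ j :: real} x \<partial>lborel)"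
    unfolding haar_square by (intro integral_mono_AE') (auto split: split_indicator intro!: integrable_mult_right integrable_real_indicator simp: emeasure_lborel_Icc_eq)
  also have "\<dots> = 1"
  proof -
    have "of_int k / 2 ^ j \<le> (of_int k + 1) / (2 :: real) ^ j" by (simp add: divide_right_mono)
    moreover have "(of_int k + 1) / 2 ^ j - of_int k / 2 ^ j = 1 / (2 :: real) ^ j" by (simp add: diff_divide_distrib[symmetric])
    ultimately show ?thesis by simp
  qed
  finally show ?thesis unfolding sigma_coef_def by (simp add: real_sqrt_le_1_iff)
qed

lemma sigma_carved_father: "(sigma_coef (indicator (carved I J p)) (-1, 0))\<^sup>2 = 1 - 2 ^ I / 2 ^ J"
proof -
  have "(haar (-1, 0) x)\<^sup>2 * indicator (carved I J p) x = haar (-1, 0) x * indicator (carved I J p) x" for x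
    unfolding haar_father by (simp split: split_indicator)
  then have "(\<integral>x. (haar (-1, 0) x)\<^sup>2 * indicator (carved I J p) x \<partial>lborel) = 1 - 2 ^ I / 2 ^ J"
    using coef_carved_father[of 0] by (simp only: coef_def) simp
  moreover have "0 \<le> 1 - (2::real) ^ I / 2 ^ J" using IJ by (simp add: power_increasing)
  ultimately show ?thesis unfolding sigma_coef_def by (simp only: real_sqrt_pow2)
qed

end

section \<open>Carved intensities belong to the classes\<close>

lemma sum_pow2_from:
  assumes "I \<le> J"
  shows "(\<Sum>j\<in>{I..<J}. 2 ^ j) = (2 :: real) ^ J - 2 ^ I"
  using assms by (induction J rule: dec_induct) (simp_all add: sum.atLeastLessThan_Suc)

text \<open>The largest power of two that does not exceed \<open>T\<close> dominates the sum of all of them.\<close>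

lemma sum_pow2_below:
  fixes T :: real
  assumes "0 \<le> T"
  shows "(\<Sum>j<J. of_bool (2 ^ j \<le> T) * 2 ^ j) \<le> 2 * T"
proof (induction J)
  case (Suc J)
  show ?case
  proof (cases "2 ^ J \<le> T")
    case True
    have "(\<Sum>j<Suc J. of_bool (2 ^ j \<le> T) * 2 ^ j) \<le> (\<Sum>j<Suc J. 2 ^ j :: real)"
      by (intro sum_mono) simp
    also have "\<dots> \<le> 2 * 2 ^ J" using sum_pow2_from[of 0 "Suc J"] by (simp add: lessThan_atLeast0)
    finally show ?thesis using True by linarith
  qed (use Suc in simp)
qed (use assms in simp)

context
  fixes I J :: nat and p :: "nat \<Rightarrow> nat"
  assumes IJ: "I \<le> J" and p: "\<And>b. b < 2 ^ I \<Longrightarrow> p b div 2 ^ (J - I) = b"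
begin

text \<open>Both class conditions bound the energy of a selection of coefficients. The selection is split into
  the father coefficient and the levels: \<open>Q0\<close> and \<open>Q j\<close> are necessary conditions for the father
  coefficient and for a coefficient of level \<open>j\<close> to be selected.\<close>

lemma carved_energy:
  assumes A: "A \<subseteq> Lam"
    and Q0: "(-1, 0) \<in> A \<Longrightarrow> P (-1, 0) \<Longrightarrow> Q0"
    and Q: "\<And>j b. I \<le> j \<Longrightarrow> j < J \<Longrightarrow> b < 2 ^ I \<Longrightarrow> (int j, int (p b div 2 ^ (J - j))) \<in> A \<Longrightarrow>
      P (int j, int (p b div 2 ^ (J - j))) \<Longrightarrow> Q j"
  shows "(\<Sum>\<^sub>\<infinity>l\<in>A. ennreal ((coef (indicator (carved I J p)) l)\<^sup>2 * of_bool (P l)))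
    \<le> ennreal (of_bool Q0 * (1 - 2 ^ I / 2 ^ J)\<^sup>2 + (\<Sum>j\<in>{I..<J}. of_bool (Q j) * (2 ^ I * 2 ^ j / 4 ^ J)))"
proof -
  define c where "c l = coef (indicator (carved I J p)) l" for l
  define e where "e l = (c l)\<^sup>2 * of_bool (P l \<and> l \<in> A)" for l
  define G where "G = (\<lambda>(j, b). (int j, int (p b div 2 ^ (J - j)))) ` ({I..<J} \<times> {..<2 ^ I})"
  define F where "F = insert (-1, 0) G"
  have F: "finite F" by (simp add: F_def G_def)
  have zero: "c l = 0" if lam: "l \<in> Lam" and notin: "l \<notin> F" for l
  proof -
    obtain j k where l: "l = (j, k)" "-1 \<le> j" using lam by (auto simp: Lam_def)
    show ?thesis
    proof (cases "j = -1")
      case True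
      then have "k \<noteq> 0" using notin by (auto simp: l F_def)
      then show ?thesis using coef_carved_father[OF IJ p, of k] True by (simp add: c_def l)
    next
      case False
      then have "0 \<le> j" using l(2) by linarith
      then obtain i where i: "j = int i" by (rule nonneg_int_cases)
      consider "i < I" | "J \<le> i" | "I \<le> i" "i < J" by linarith
      then show ?thesis
      proof cases
        case 3
        have "k \<notin> (\<lambda>b. int (p b div 2 ^ (J - i))) ` {..<2 ^ I}"
          using notin 3 by (auto simp: l i F_def G_def)
        then show ?thesis using coef_carved_middle(2)[OF IJ p 3] by (simp add: c_def l i)
      qed (simp_all add: c_def l i coef_carved_coarse[OF IJ p] coef_carved_fine[OF IJ p])
    qed
  qed
  have "(\<Sum>\<^sub>\<infinity>l\<in>A. ennreal ((c l)\<^sup>2 * of_bool (P l))) = (\<Sum>\<^sub>\<infinity>l\<in>F. ennreal (e l))"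
  proof (rule infsum_cong_neutral)
    fix l assume "l \<in> F - A"
    then show "ennreal (e l) = 0" by (simp add: e_def)
  next
    fix l assume "l \<in> A - F"
    then show "ennreal ((c l)\<^sup>2 * of_bool (P l)) = 0" using zero[of l] A by auto
  qed (simp add: e_def)
  also have "\<dots> = ennreal (\<Sum>l\<in>F. e l)" using F by (simp add: e_def)
  also have "\<dots> \<le> ennreal (of_bool Q0 * (1 - 2 ^ I / 2 ^ J)\<^sup>2 + (\<Sum>j\<in>{I..<J}. of_bool (Q j) * (2 ^ I * 2 ^ j / 4 ^ J)))"
  proof (rule ennreal_leI)
    have "(\<Sum>l\<in>F. e l) = e (-1, 0) + (\<Sum>l\<in>G. e l)"
      unfolding F_def by (subst sum.insert) (auto simp: G_def)
    also have "e (-1, 0) \<le> of_bool Q0 * (1 - 2 ^ I / 2 ^ J)\<^sup>2"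
      using Q0 coef_carved_father[OF IJ p, of 0] by (auto simp: e_def c_def)
    also have "(\<Sum>l\<in>G. e l) \<le> (\<Sum>(j, b)\<in>{I..<J} \<times> {..<2 ^ I}. e (int j, int (p b div 2 ^ (J - j))))"
      unfolding G_def by (rule order.trans[OF sum_image_le]) (auto simp: e_def case_prod_beta)
    also have "\<dots> = (\<Sum>j\<in>{I..<J}. \<Sum>b<2 ^ I. e (int j, int (p b div 2 ^ (J - j))))"
      by (simp add: sum.cartesian_product)
    also have "\<dots> \<le> (\<Sum>j\<in>{I..<J}. \<Sum>b<(2::nat) ^ I. of_bool (Q j) * (2 ^ j / 4 ^ J))"
    proof (intro sum_mono)
      fix j b assume j: "j \<in> {I..<J}" and b: "b \<in> {..<(2::nat) ^ I}"
      have "(c (int j, int (p b div 2 ^ (J - j))))\<^sup>2 = (2 powr (real j / 2) / 2 ^ J)\<^sup>2"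
        using coef_carved_middle(1)[OF IJ p, of j b] j b unfolding c_def by (metis atLeastLessThan_iff lessThan_iff power2_abs)
      also have "\<dots> = 2 ^ j / 4 ^ J"
        by (simp add: power_divide power2_eq_square powr_add[symmetric] powr_realpow power_mult_distrib[symmetric])
      finally show "e (int j, int (p b div 2 ^ (J - j))) \<le> of_bool (Q j) * (2 ^ j / 4 ^ J)"
        unfolding e_def using Q[of j b] j b by auto
    qed
    also have "\<dots> = (\<Sum>j\<in>{I..<J}. of_bool (Q j) * (2 ^ I * 2 ^ j / 4 ^ J))"
      by (simp add: mult_ac)
    finally show "(\<Sum>l\<in>F. e l) \<le> of_bool Q0 * (1 - 2 ^ I / 2 ^ J)\<^sup>2 + (\<Sum>j\<in>{I..<J}. of_bool (Q j) * (2 ^ I * 2 ^ j / 4 ^ J))"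
      by simp
  qed
  finally show ?thesis unfolding c_def .
qed

lemma carved_square: "(indicator (carved I J p) x :: real)\<^sup>2 = indicator (carved I J p) x"
  by (simp split: split_indicator)

lemma carved_integrable: "integrable lborel (indicator (carved I J p) :: real \<Rightarrow> real)"
proof (rule integrable_real_indicator)
  have "emeasure lborel (carved I J p) \<le> emeasure lborel {0..<1::real}"
    by (rule emeasure_mono) (auto simp: carved_def cell_unit)
  then show "emeasure lborel (carved I J p) < \<infinity>" by (simp add: le_less_trans[of _ 1])
qed simp

lemma carved_L1L2: "indicator (carved I J p) \<in> L1_fun" "indicator (carved I J p) \<in> L2_fun"
  using carved_integrable by (simp_all add: L1_fun_def L2_fun_def carved_square)

lemma carved_intensity: "indicator (carved I J p) \<in> intensities"
  using carved_L1L2 by (simp add: intensities_def)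

lemma carved_L_class:
  assumes "1 \<le> R"
  shows "indicator (carved I J p) \<in> L_class R"
proof -
  have "measure lborel (carved I J p) \<le> measure lborel {0..<1::real}"
    by (rule measure_mono_fmeasurable) (auto simp: carved_def cell_unit fmeasurable_def)
  then have m: "measure lborel (carved I J p) \<le> 1" by simp
  have "esssup lborel (\<lambda>x. ennreal \<bar>indicator (carved I J p) x\<bar>) \<le> ennreal R"
    using assms by (intro esssup_I AE_I2) (auto split: split_indicator simp: ennreal_leI)
  moreover have "(\<integral>x. \<bar>indicator (carved I J p) x\<bar> \<partial>lborel) \<le> R" using m assms by simp
  moreover have "sqrt (\<integral>x. (indicator (carved I J p) x)\<^sup>2 \<partial>lborel) \<le> R"
  proof -
    have "sqrt (\<integral>x. (indicator (carved I J p) x)\<^sup>2 \<partial>lborel) \<le> sqrt 1"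
      unfolding carved_square using m by (intro real_sqrt_le_mono) simp
    then show ?thesis using assms unfolding real_sqrt_one by linarith
  qed
  ultimately show ?thesis using carved_L1L2 by (simp add: L_class_def)
qed

end

text \<open>The inequality behind membership in \<open>W_class\<close>. If the father coefficient is selected, the total
  energy is at most the mass \<open>\<beta> \<le> 1\<close> of the carved set, and \<open>\<beta> \<le> \<beta>^(2s) \<le> t^(4s)\<close> since
  \<open>2 * s < 1\<close>. Otherwise, with \<open>T = t\<^sup>2 * 4^J\<close>, the selected powers \<open>2^j\<close> add up to at most
  \<open>2 * T\<close> and to at most \<open>2^J\<close>; interpolating between the two bounds with weights \<open>2 * s\<close> and
  \<open>1 - 2 * s\<close> yields the power \<open>t^(4s)\<close>.\<close>

lemma energy_below_threshold:
  fixes s t K :: real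
  assumes s: "0 < s" "s < 1 / 2" and t: "0 < t" and K: "1 \<le> K" and IJ: "I \<le> J"
    and I: "2 ^ I \<le> K * (2 ^ J) powr (1 - 2 * s) / 4"
  shows "of_bool (1 - 2 ^ I / 2 ^ J \<le> t\<^sup>2) * (1 - 2 ^ I / 2 ^ J)\<^sup>2
      + (\<Sum>j\<in>{I..<J}. of_bool (2 ^ j / 4 ^ J \<le> t\<^sup>2) * (2 ^ I * 2 ^ j / 4 ^ J)) \<le> K * t powr (4 * s)"
proof -
  define x where "x = (2::real) ^ I / 2 ^ J"
  have x: "0 < x" "x \<le> 1" using IJ by (auto simp: x_def power_increasing)
  have J4: "(4::real) ^ J = 2 ^ J * 2 ^ J" by (simp add: power_mult_distrib[symmetric])
  have t4: "(t\<^sup>2) powr (2 * s) = t powr (4 * s)"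
    using t by (simp add: powr_powr powr_numeral[symmetric] del: powr_numeral)
  show ?thesis
  proof (cases "1 - x \<le> t\<^sup>2")
    case True
    have "(\<Sum>j\<in>{I..<J}. of_bool (2 ^ j / 4 ^ J \<le> t\<^sup>2) * (2 ^ I * 2 ^ j / 4 ^ J)) \<le> (\<Sum>j\<in>{I..<J}. 2 ^ I * 2 ^ j / (4::real) ^ J)"
      by (intro sum_mono) simp
    also have "\<dots> = 2 ^ I / 4 ^ J * (\<Sum>j\<in>{I..<J}. 2 ^ j)" by (simp add: sum_distrib_left)
    also have "\<dots> = x - x\<^sup>2"
      unfolding sum_pow2_from[OF IJ] J4 x_def by (simp add: field_simps power2_eq_square)
    finally have "of_bool (1 - x \<le> t\<^sup>2) * (1 - x)\<^sup>2
        + (\<Sum>j\<in>{I..<J}. of_bool (2 ^ j / 4 ^ J \<le> t\<^sup>2) * (2 ^ I * 2 ^ j / 4 ^ J)) \<le> (1 - x)\<^sup>2 + (x - x\<^sup>2)"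
      using True by simp
    also have "\<dots> = 1 - x" by (simp add: power2_eq_square algebra_simps)
    also have "\<dots> \<le> (1 - x) powr (2 * s)"
    proof (cases "x = 1")
      case False
      then have "(1 - x) powr 1 \<le> (1 - x) powr (2 * s)"
        using x s by (intro powr_mono') auto
      then show ?thesis using x False by simp
    qed simp
    also have "\<dots> \<le> (t\<^sup>2) powr (2 * s)" using True x s by (intro powr_mono2) auto
    also have "\<dots> \<le> K * (t\<^sup>2) powr (2 * s)" using K by (simp add: mult_right_le_one_le mult_le_cancel_right1)
    finally show ?thesis by (simp add: x_def t4)
  next
    case False
    \<comment> \<open>\<open>T\<close> rescales the threshold for coefficients into a threshold for powers of two\<close>
    define T where "T = t\<^sup>2 * 4 ^ J"
    have T: "0 < T" using t by (simp add: T_def)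
    have cond: "2 ^ j / 4 ^ J \<le> t\<^sup>2 \<longleftrightarrow> 2 ^ j \<le> T" for j by (simp add: T_def field_simps)
    define S where "S = (\<Sum>j<J. of_bool (2 ^ j \<le> T) * 2 ^ j :: real)"
    have S0: "0 \<le> S" unfolding S_def by (intro sum_nonneg) simp
    have "S \<le> (\<Sum>j<J. 2 ^ j)" unfolding S_def by (intro sum_mono) simp
    also have "\<dots> \<le> 2 ^ J" using sum_pow2_from[of 0 J] by (simp add: lessThan_atLeast0)
    finally have S1: "S \<le> 2 ^ J" .
    have S2: "S \<le> 2 * T" unfolding S_def by (rule sum_pow2_below) (use T in simp)
    have S3: "S \<le> 2 * T powr (2 * s) * (2 ^ J) powr (1 - 2 * s)"
    proof (cases "S = 0")
      case False
      then have "S = S powr (2 * s) * S powr (1 - 2 * s)" using S0 by (simp add: powr_add[symmetric])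
      also have "\<dots> \<le> (2 * T) powr (2 * s) * (2 ^ J) powr (1 - 2 * s)"
        using S0 S1 S2 s by (intro mult_mono powr_mono2) auto
      also have "(2 * T) powr (2 * s) = 2 powr (2 * s) * T powr (2 * s)" using T by (simp add: powr_mult)
      also have "2 powr (2 * s) * T powr (2 * s) * (2 ^ J) powr (1 - 2 * s) \<le> 2 powr 1 * T powr (2 * s) * (2 ^ J) powr (1 - 2 * s)"
        using s by (intro mult_right_mono powr_mono) auto
      finally show ?thesis by simp
    qed simp
    have T2: "T powr (2 * s) * (2 ^ J) powr (1 - 2 * s) = t powr (4 * s) * (4 ^ J / (2 ^ J) powr (1 - 2 * s))"
    proof -
      have "T powr (2 * s) = t powr (4 * s) * (4 ^ J) powr (2 * s)"
        unfolding T_def using t4 by (simp add: powr_mult)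
      moreover have "(4 ^ J) powr (2 * s) * (2 ^ J) powr (1 - 2 * s) * (2 ^ J) powr (1 - 2 * s) = (4::real) ^ J"
      proof -
        have "(2 ^ J) powr (1 - 2 * s) * (2 ^ J) powr (1 - 2 * s) = ((4::real) ^ J) powr (1 - 2 * s)"
          by (simp add: J4 powr_mult)
        then show ?thesis by (simp add: mult.assoc powr_add[symmetric])
      qed
      ultimately show ?thesis by (simp add: field_simps)
    qed
    have "(\<Sum>j\<in>{I..<J}. of_bool (2 ^ j / 4 ^ J \<le> t\<^sup>2) * (2 ^ I * 2 ^ j / (4::real) ^ J))
        \<le> (\<Sum>j<J. of_bool (2 ^ j / 4 ^ J \<le> t\<^sup>2) * (2 ^ I * 2 ^ j / 4 ^ J))"
      by (intro sum_mono2) auto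
    also have "\<dots> = 2 ^ I / 4 ^ J * S"
      unfolding S_def cond sum_distrib_left by (intro sum.cong) simp_all
    also have "\<dots> \<le> 2 ^ I / 4 ^ J * (2 * (t powr (4 * s) * (4 ^ J / (2 ^ J) powr (1 - 2 * s))))"
      using S3 T2 by (intro mult_left_mono) (auto simp: mult.assoc)
    also have "\<dots> = 2 * t powr (4 * s) * (2 ^ I / (2 ^ J) powr (1 - 2 * s))" by simp
    also have "2 ^ I / (2 ^ J) powr (1 - 2 * s) \<le> K / 4" using I by (simp add: field_simps)
    also have "2 * t powr (4 * s) * (K / 4) \<le> K * t powr (4 * s)" using K by simp
    finally show ?thesis using False by (simp add: x_def mult_left_mono)
  qed
qed

context
  fixes I J :: nat and p :: "nat \<Rightarrow> nat" and s R :: real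
  assumes IJ: "I \<le> J" and p: "\<And>b. b < 2 ^ I \<Longrightarrow> p b div 2 ^ (J - I) = b"
    and s: "0 < s" "s < 1 / 2"
    and I: "2 ^ I \<le> R powr (2 - 4 * s) * (2 ^ J) powr (1 - 2 * s) / 4"
begin

lemma carved_W_class:
  assumes R: "1 \<le> R powr (2 - 4 * s)"
  shows "indicator (carved I J p) \<in> W_class s R"
proof -
  let ?f = "indicator (carved I J p)"
  have "ennreal (t powr (- 4 * s)) *
      (\<Sum>\<^sub>\<infinity>l\<in>Lam. ennreal ((coef ?f l)\<^sup>2 * of_bool (\<bar>coef ?f l\<bar> \<le> sigma_coef ?f l * t))) \<le> ennreal (R powr (2 - 4 * s))"
    if t: "0 < t" for t
  proof -
    have "(\<Sum>\<^sub>\<infinity>l\<in>Lam. ennreal ((coef ?f l)\<^sup>2 * of_bool (\<bar>coef ?f l\<bar> \<le> sigma_coef ?f l * t)))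
      \<le> ennreal (of_bool (1 - 2 ^ I / 2 ^ J \<le> t\<^sup>2) * (1 - 2 ^ I / 2 ^ J)\<^sup>2
        + (\<Sum>j\<in>{I..<J}. of_bool (2 ^ j / 4 ^ J \<le> t\<^sup>2) * (2 ^ I * 2 ^ j / 4 ^ J)))"
    proof (rule carved_energy[OF IJ p])
      assume "\<bar>coef ?f (-1, 0)\<bar> \<le> sigma_coef ?f (-1, 0) * t"
      then have "\<bar>coef ?f (-1, 0)\<bar>\<^sup>2 \<le> (sigma_coef ?f (-1, 0) * t)\<^sup>2" by (intro power_mono) auto
      then have le: "(1 - 2 ^ I / 2 ^ J)\<^sup>2 \<le> (1 - 2 ^ I / 2 ^ J) * t\<^sup>2"
        by (simp only: power_mult_distrib sigma_carved_father[OF IJ p] coef_carved_father[OF IJ p] power2_abs if_True refl)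
      have "(0::real) \<le> 1 - 2 ^ I / 2 ^ J" using IJ by (simp add: power_increasing)
      then show "1 - 2 ^ I / 2 ^ J \<le> t\<^sup>2"
      proof (cases "1 - (2::real) ^ I / 2 ^ J = 0")
        case False
        then have "0 < 1 - (2::real) ^ I / 2 ^ J" using \<open>0 \<le> 1 - 2 ^ I / 2 ^ J\<close> by linarith
        then show ?thesis using le unfolding power2_eq_square[of "1 - 2 ^ I / 2 ^ J"] by (simp only: mult_le_cancel_left_pos)
      qed simp
    next
      fix j b assume j: "I \<le> j" "j < J" and b: "b < (2::nat) ^ I"
        and le: "\<bar>coef ?f (int j, int (p b div 2 ^ (J - j)))\<bar> \<le> sigma_coef ?f (int j, int (p b div 2 ^ (J - j))) * t"
      have "2 powr (real j / 2) / 2 ^ J = \<bar>coef ?f (int j, int (p b div 2 ^ (J - j)))\<bar>"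
        by (rule coef_carved_middle(1)[OF IJ p j b, symmetric])
      also note le
      also have "sigma_coef ?f (int j, int (p b div 2 ^ (J - j))) * t \<le> 1 * t"
        using t sigma_carved_le[OF IJ p] by (intro mult_right_mono) auto
      finally have "2 powr (real j / 2) / 2 ^ J \<le> t" by simp
      then have "(2 powr (real j / 2) / 2 ^ J)\<^sup>2 \<le> t\<^sup>2" by (intro power_mono) auto
      then show "2 ^ j / 4 ^ J \<le> t\<^sup>2"
        by (simp add: power_divide power2_eq_square powr_add[symmetric] powr_realpow power_mult_distrib[symmetric])
    qed simp_all
    also have "\<dots> \<le> ennreal (R powr (2 - 4 * s) * t powr (4 * s))"
      by (intro ennreal_leI energy_below_threshold[OF s t R IJ I])
    finally have "ennreal (t powr (- 4 * s)) *
      (\<Sum>\<^sub>\<infinity>l\<in>Lam. ennreal ((coef ?f l)\<^sup>2 * of_bool (\<bar>coef ?f l\<bar> \<le> sigma_coef ?f l * t)))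
      \<le> ennreal (t powr (- 4 * s)) * ennreal (R powr (2 - 4 * s) * t powr (4 * s))"
      by (intro mult_left_mono) auto
    also have "\<dots> = ennreal (t powr (- 4 * s) * (R powr (2 - 4 * s) * t powr (4 * s)))"
      by (rule ennreal_mult'[symmetric]) simp
    also have "t powr (- 4 * s) * (R powr (2 - 4 * s) * t powr (4 * s)) = R powr (2 - 4 * s)"
      using t by (simp add: powr_minus field_simps)
    finally show ?thesis .
  qed
  then show ?thesis using carved_L1L2(2)[OF IJ p] unfolding W_class_def by (auto intro!: SUP_least)
qed

text \<open>The tail of the expansion beyond the levels kept in \<open>Gam n\<close> is nonzero only if \<open>j0 n + 1 < J\<close>. It is
  then at most \<open>2^I / 2^J\<close>, while \<open>n / ln n < 2^J\<close> bounds the weight by \<open>(2^J)^(2s)\<close>.\<close>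

lemma carved_B_class:
  assumes R': "R powr (1 - 2 * s) \<le> R'"
  shows "indicator (carved I J p) \<in> B_class s Gam R'"
proof -
  let ?f = "indicator (carved I J p)"
  have "ennreal ((ln (real n) / real n) powr (- 2 * s)) * (\<Sum>\<^sub>\<infinity>l\<in>Lam - Gam n. ennreal ((coef ?f l)\<^sup>2)) \<le> ennreal (R'\<^sup>2)"
    if n: "2 \<le> n" for n
  proof -
    have ln: "0 < ln (real n)" using n by simp
    have "ln (real n) \<le> real n" using ln_le_minus_one[of "real n"] n by linarith
    then have "1 \<le> real n / ln (real n)" using ln by simp
    then have "2 powr 0 < 2 powr (real_of_int (j0 n) + 1)" using j0_bounds(2)[OF n] by simp
    then have "0 < real_of_int (j0 n) + 1" by (simp only: powr_less_cancel_iff)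
    then have j0: "-1 < j0 n" by linarith
    have "(\<Sum>\<^sub>\<infinity>l\<in>Lam - Gam n. ennreal ((coef ?f l)\<^sup>2 * of_bool True))
      \<le> ennreal (of_bool False * (1 - 2 ^ I / 2 ^ J)\<^sup>2
        + (\<Sum>j\<in>{I..<J}. of_bool (j0 n < int j) * (2 ^ I * 2 ^ j / 4 ^ J)))"
      by (rule carved_energy[OF IJ p]) (use j0 in \<open>auto simp: Gam_def Lam_def\<close>)
    also have "(\<Sum>j\<in>{I..<J}. of_bool (j0 n < int j) * (2 ^ I * 2 ^ j / 4 ^ J)) \<le> of_bool (j0 n + 1 < int J) * ((2::real) ^ I / 2 ^ J)"
    proof (cases "j0 n + 1 < int J")
      case True
      have "(\<Sum>j\<in>{I..<J}. of_bool (j0 n < int j) * (2 ^ I * 2 ^ j / 4 ^ J)) \<le> (\<Sum>j\<in>{I..<J}. 2 ^ I * 2 ^ j / (4::real) ^ J)"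
        by (intro sum_mono) simp
      also have "\<dots> = 2 ^ I / 4 ^ J * (\<Sum>j\<in>{I..<J}. 2 ^ j)" by (simp add: sum_distrib_left)
      also have "\<dots> \<le> 2 ^ I / 4 ^ J * 2 ^ J"
        unfolding sum_pow2_from[OF IJ] by (intro mult_left_mono) auto
      also have "\<dots> = 2 ^ I / 2 ^ J"
        by (simp add: field_simps power_mult_distrib[symmetric])
      finally show ?thesis using True by simp
    next
      case False
      then show ?thesis by (auto intro!: sum_nonpos)
    qed
    finally have "(\<Sum>\<^sub>\<infinity>l\<in>Lam - Gam n. ennreal ((coef ?f l)\<^sup>2)) \<le> ennreal (of_bool (j0 n + 1 < int J) * (2 ^ I / 2 ^ J))"
      by (simp add: ennreal_leI)
    then have "ennreal ((ln (real n) / real n) powr (- 2 * s)) * (\<Sum>\<^sub>\<infinity>l\<in>Lam - Gam n. ennreal ((coef ?f l)\<^sup>2))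
      \<le> ennreal ((ln (real n) / real n) powr (- 2 * s)) * ennreal (of_bool (j0 n + 1 < int J) * (2 ^ I / 2 ^ J))"
      by (intro mult_left_mono) auto
    also have "\<dots> = ennreal ((ln (real n) / real n) powr (- 2 * s) * (of_bool (j0 n + 1 < int J) * (2 ^ I / 2 ^ J)))"
      by (rule ennreal_mult'[symmetric]) simp
    also have "\<dots> \<le> ennreal (R'\<^sup>2)"
    proof (rule ennreal_leI, cases "j0 n + 1 < int J")
      case True
      have "real n / ln (real n) < 2 powr (real_of_int (j0 n) + 1)" by (rule j0_bounds(2)[OF n])
      also have "\<dots> \<le> 2 powr real J" using True by (intro powr_mono) auto
      finally have "inverse (2 ^ J) \<le> ln (real n) / real n" using ln n by (simp add: powr_realpow field_simps)
      then have "(ln (real n) / real n) powr (- 2 * s) \<le> (inverse (2 ^ J)) powr (- 2 * s)"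
        using s by (intro powr_mono2') auto
      also have "\<dots> = (2 ^ J) powr (2 * s)" by (simp add: powr_minus inverse_powr)
      finally have "(ln (real n) / real n) powr (- 2 * s) * (2 ^ I / 2 ^ J) \<le> (2 ^ J) powr (2 * s) * (2 ^ I / 2 ^ J)"
        by (intro mult_right_mono) auto
      also have "\<dots> \<le> (2 ^ J) powr (2 * s) * (R powr (2 - 4 * s) * (2 ^ J) powr (1 - 2 * s) / 4 / 2 ^ J)"
        using I by (intro mult_left_mono divide_right_mono) auto
      also have "\<dots> = R powr (2 - 4 * s) / 4 * ((2 ^ J) powr (2 * s) * (2 ^ J) powr (1 - 2 * s) / 2 ^ J)" by simp
      also have "(2 ^ J) powr (2 * s) * (2 ^ J) powr (1 - 2 * s) / 2 ^ J = (1::real)"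
        by (simp add: powr_add[symmetric])
      also have "R powr (2 - 4 * s) / 4 * 1 \<le> (R powr (1 - 2 * s))\<^sup>2"
        by (simp add: power2_eq_square powr_add[symmetric])
      also have "\<dots> \<le> R'\<^sup>2" using R' by (intro power_mono) auto
      finally show "(ln (real n) / real n) powr (- 2 * s) * (of_bool (j0 n + 1 < int J) * (2 ^ I / 2 ^ J)) \<le> R'\<^sup>2"
        using True by simp
    qed simp
    finally show ?thesis .
  qed
  then show ?thesis using carved_L1L2(2)[OF IJ p] unfolding B_class_def by (auto intro!: SUP_least)
qed

end

section \<open>An average-case bound for independent voids\<close>

text \<open>Resampling one coordinate preserves the uniform distribution: exchanging the old and the new value
  of the coordinate is an involution.\<close>

lemma sum_PiE_resample:
  fixes h :: "(nat \<Rightarrow> nat) \<Rightarrow> real"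
  assumes "b < m"
  shows "(\<Sum>\<theta>\<in>PiE {..<m} (\<lambda>_. {..<L}). \<Sum>k<L. h (\<theta>(b := k))) = real L * (\<Sum>\<theta>\<in>PiE {..<m} (\<lambda>_. {..<L}). h \<theta>)"
proof -
  let ?T = "PiE {..<m} (\<lambda>_. {..<L})"
  have upd: "\<theta>(b := k) \<in> ?T" if "\<theta> \<in> ?T" "k < L" for \<theta> k
    using that assms by (auto simp: PiE_iff extensional_def)
  have "(\<Sum>\<theta>\<in>?T. \<Sum>k<L. h (\<theta>(b := k))) = (\<Sum>(\<theta>, k)\<in>?T \<times> {..<L}. h (\<theta>(b := k)))"
    by (rule sum.cartesian_product)
  also have "\<dots> = (\<Sum>(\<theta>, k)\<in>?T \<times> {..<L}. h \<theta>)"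
    by (rule sum.reindex_bij_witness[where i = "\<lambda>(\<theta>, k). (\<theta>(b := k), \<theta> b)" and j = "\<lambda>(\<theta>, k). (\<theta>(b := k), \<theta> b)"])
       (use upd assms in \<open>auto simp: PiE_iff\<close>)
  also have "\<dots> = (\<Sum>\<theta>\<in>?T. \<Sum>k<L. h \<theta>)"
    by (rule sum.cartesian_product[symmetric])
  finally show ?thesis by (simp add: sum_distrib_left)
qed

text \<open>Among losses that are pairwise separated, at most one is below \<open>\<delta>\<close>; the summand \<open>\<delta>\<close> on the right
  pays for it.\<close>

lemma separated_losses:
  fixes v :: "nat \<Rightarrow> ennreal" and z :: "nat \<Rightarrow> bool"
  assumes \<delta>: "0 \<le> \<delta>"
    and sep: "\<And>k k'. k < L \<Longrightarrow> k' < L \<Longrightarrow> k \<noteq> k' \<Longrightarrow> ennreal (2 * \<delta>) \<le> v k + v k'"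
  shows "(\<Sum>k<L. ennreal \<delta> * of_bool (z k)) \<le> (\<Sum>k<L. v k * of_bool (z k)) + ennreal \<delta>"
proof (cases "\<exists>k0<L. v k0 < ennreal \<delta>")
  case True
  then obtain k0 where k0: "k0 < L" "v k0 < ennreal \<delta>" by blast
  have ge: "ennreal \<delta> \<le> v k" if "k < L" "k \<noteq> k0" for k
  proof (rule ccontr)
    assume "\<not> ennreal \<delta> \<le> v k"
    then have "v k + v k0 < ennreal \<delta> + ennreal \<delta>" using k0(2) by (intro add_strict_mono) auto
    also have "\<dots> = ennreal (2 * \<delta>)" using \<delta> by (simp add: ennreal_plus[symmetric] del: ennreal_plus)
    finally show False using sep[of k k0] that k0(1) by simp
  qed
  have "(\<Sum>k<L. ennreal \<delta> * of_bool (z k))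
      = (\<Sum>k\<in>{..<L} - {k0}. ennreal \<delta> * of_bool (z k)) + ennreal \<delta> * of_bool (z k0)"
    using sum.remove[OF finite_lessThan, of k0 L "\<lambda>k. ennreal \<delta> * of_bool (z k)"] k0
    by (simp only: lessThan_iff add.commute)
  also have "\<dots> \<le> (\<Sum>k\<in>{..<L} - {k0}. v k * of_bool (z k)) + ennreal \<delta>"
    using ge by (intro add_mono sum_mono mult_right_mono) auto
  also have "\<dots> \<le> (\<Sum>k<L. v k * of_bool (z k)) + ennreal \<delta>"
    by (intro add_right_mono sum_mono2) auto
  finally show ?thesis .
next
  case False
  then have "(\<Sum>k<L. ennreal \<delta> * of_bool (z k)) \<le> (\<Sum>k<L. v k * of_bool (z k))"
    by (intro sum_mono mult_right_mono) auto
  then show ?thesis by (rule order_trans) simp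
qed

text \<open>The space is the base law, \<open>Z b k\<close> is the event that candidate \<open>k\<close> for the hole in block \<open>b\<close>
  is empty, and \<open>V b k\<close> is the loss on that block when the hole is at \<open>k\<close>. The separation of the
  losses for different candidates is all that is known about the estimator.\<close>

context prob_space
begin

context
  fixes Z :: "nat \<Rightarrow> nat \<Rightarrow> 'a set" and V :: "nat \<Rightarrow> nat \<Rightarrow> 'a \<Rightarrow> ennreal" and m L :: nat and q \<delta> :: real
  assumes Z: "\<And>b k. Z b k \<in> events" and V: "\<And>b k. V b k \<in> borel_measurable M"
    and \<delta>: "0 < \<delta>" and q: "0 < q" "2 \<le> real L * q"
    and sep: "\<And>x b k k'. x \<in> space M \<Longrightarrow> b < m \<Longrightarrow> k < L \<Longrightarrow> k' < L \<Longrightarrow> k \<noteq> k' \<Longrightarrow> ennreal (2 * \<delta>) \<le> V b k x + V b k' x"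
    and ind: "\<And>S \<theta>. S \<subseteq> {..<m} \<Longrightarrow> (\<And>b. b \<in> S \<Longrightarrow> \<theta> b < L) \<Longrightarrow>
      prob {x\<in>space M. \<forall>b\<in>S. x \<in> Z b (\<theta> b)} = q ^ card S"
begin

text \<open>The competing laws for the positions \<open>k\<close> of the hole in block \<open>b\<close> are restrictions of \<open>M\<close> to
  events of probability \<open>q ^ m\<close>, up to normalisation. Whatever the data, at most one position is estimated well, so the
  losses add up to at least \<open>\<delta>\<close> times the number of empty candidates minus one. The expectation of that
  number, on the event that the holes of the other blocks are empty, is \<open>L * q ^ m\<close>; the expectation of
  the one is \<open>q ^ (m - 1)\<close>, at most half as much.\<close>

lemma block_average:
  assumes b: "b < m" and \<theta>: "\<And>b. b < m \<Longrightarrow> \<theta> b < L"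
  shows "ennreal (real L * \<delta> * q ^ m / 2)
    \<le> (\<Sum>k<L. \<integral>\<^sup>+x. V b k x * indicator {x\<in>space M. \<forall>b'\<in>{..<m}. x \<in> Z b' ((\<theta>(b := k)) b')} x \<partial>M)"
proof -
  let ?W = "\<lambda>k. {x\<in>space M. \<forall>b'\<in>{..<m}. x \<in> Z b' ((\<theta>(b := k)) b')}"
  let ?R = "{x\<in>space M. \<forall>b'\<in>{..<m} - {b}. x \<in> Z b' (\<theta> b')}"
  have meas: "{x\<in>space M. \<forall>b'\<in>S. x \<in> Z b' (\<theta>' b')} \<in> events" if "finite S" for S \<theta>'
    using that Z by (intro sets.sets_Collect_finite_All) auto
  have W: "?W k \<in> events" for k by (rule meas) simp
  have R: "?R \<in> events" by (rule meas) simp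
  have ind_W: "indicator (?W k) x = (indicator ?R x * of_bool (x \<in> Z b k) :: ennreal)" if "x \<in> space M" for x k
    using b that by (auto simp: indicator_def)
  have point: "(\<Sum>k<L. ennreal \<delta> * indicator (?W k) x) \<le> (\<Sum>k<L. V b k x * indicator (?W k) x) + ennreal \<delta> * indicator ?R x"
    if x: "x \<in> space M" for x
  proof -
    have "(\<Sum>k<L. ennreal \<delta> * of_bool (x \<in> Z b k)) \<le> (\<Sum>k<L. V b k x * of_bool (x \<in> Z b k)) + ennreal \<delta>"
      using \<delta> sep[OF x b] by (intro separated_losses) auto
    then have "indicator ?R x * (\<Sum>k<L. ennreal \<delta> * of_bool (x \<in> Z b k))
        \<le> indicator ?R x * ((\<Sum>k<L. V b k x * of_bool (x \<in> Z b k)) + ennreal \<delta>)"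
      by (intro mult_left_mono) auto
    moreover have "(\<Sum>k<L. c k * indicator (?W k) x) = indicator ?R x * (\<Sum>k<L. c k * of_bool (x \<in> Z b k))" for c :: "nat \<Rightarrow> ennreal"
      unfolding sum_distrib_left by (intro sum.cong refl) (simp only: ind_W[OF x] mult_ac)
    ultimately show ?thesis by (simp only: distrib_left mult.commute[of "ennreal \<delta>" "indicator ?R x"])
  qed
  have "(\<Sum>k<L. ennreal \<delta> * emeasure M (?W k)) = (\<integral>\<^sup>+x. (\<Sum>k<L. ennreal \<delta> * indicator (?W k) x) \<partial>M)"
    using W by (subst nn_integral_sum) (auto simp: nn_integral_cmult_indicator)
  also have "\<dots> \<le> (\<integral>\<^sup>+x. (\<Sum>k<L. V b k x * indicator (?W k) x) + ennreal \<delta> * indicator ?R x \<partial>M)"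
    by (rule nn_integral_mono) (rule point)
  also have "\<dots> = (\<Sum>k<L. \<integral>\<^sup>+x. V b k x * indicator (?W k) x \<partial>M) + ennreal \<delta> * emeasure M ?R"
  proof -
    have VW: "(\<lambda>x. V b k x * indicator (?W k) x) \<in> borel_measurable M" for k
      by (rule borel_measurable_times_ennreal[OF V borel_measurable_indicator[OF W]])
    have "(\<lambda>x. ennreal \<delta> * indicator ?R x) \<in> borel_measurable M"
      by (rule borel_measurable_times_ennreal[OF measurable_const borel_measurable_indicator[OF R]]) simp
    from nn_integral_add[OF borel_measurable_sum[OF VW] this] show ?thesis
      by (simp only: nn_integral_sum[OF VW] nn_integral_cmult_indicator[OF R])
  qed
  finally have main: "(\<Sum>k<L. ennreal \<delta> * emeasure M (?W k))
    \<le> (\<Sum>k<L. \<integral>\<^sup>+x. V b k x * indicator (?W k) x \<partial>M) + ennreal \<delta> * emeasure M ?R" .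
  have eW: "emeasure M (?W k) = ennreal (q ^ m)" if "k < L" for k
    unfolding emeasure_eq_measure using \<theta> that by (subst ind) simp_all
  have "card ({..<m} - {b}) = m - 1" using b by simp
  then have eR: "emeasure M ?R = ennreal (q ^ (m - 1))"
    unfolding emeasure_eq_measure using \<theta> by (subst ind) auto
  have qm: "q ^ m = q * q ^ (m - 1)" using b by (cases m) auto
  have "2 * q ^ (m - 1) \<le> real L * q * q ^ (m - 1)" using q by (intro mult_right_mono) auto
  then have half: "q ^ (m - 1) \<le> real L * q ^ m / 2" by (simp add: qm)
  have "(\<Sum>k<L. ennreal \<delta> * emeasure M (?W k)) = (\<Sum>k<L. ennreal \<delta> * ennreal (q ^ m))"
    by (intro sum.cong refl) (simp only: eW lessThan_iff)
  also have "\<dots> = ennreal (real L * \<delta> * q ^ m)"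
    using \<delta> q by (simp add: ennreal_mult'[symmetric] ennreal_of_nat_eq_real_of_nat mult.assoc)
  also have "real L * \<delta> * q ^ m = real L * \<delta> * q ^ m / 2 + real L * \<delta> * q ^ m / 2" by simp
  also have "ennreal \<dots> = ennreal (real L * \<delta> * q ^ m / 2) + ennreal (real L * \<delta> * q ^ m / 2)"
    using \<delta> q by (intro ennreal_plus) auto
  finally have l: "(\<Sum>k<L. ennreal \<delta> * emeasure M (?W k)) = ennreal (real L * \<delta> * q ^ m / 2) + ennreal (real L * \<delta> * q ^ m / 2)" .
  have "ennreal \<delta> * emeasure M ?R = ennreal (\<delta> * q ^ (m - 1))"
    using \<delta> by (simp add: eR ennreal_mult')
  also have "\<dots> \<le> ennreal (\<delta> * (real L * q ^ m / 2))"
    using \<delta> half by (intro ennreal_leI mult_left_mono) auto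
  also have "\<delta> * (real L * q ^ m / 2) = real L * \<delta> * q ^ m / 2" by simp
  finally have "ennreal \<delta> * emeasure M ?R \<le> ennreal (real L * \<delta> * q ^ m / 2)" .
  then have "ennreal (real L * \<delta> * q ^ m / 2) + ennreal (real L * \<delta> * q ^ m / 2)
    \<le> (\<Sum>k<L. \<integral>\<^sup>+x. V b k x * indicator (?W k) x \<partial>M) + ennreal (real L * \<delta> * q ^ m / 2)"
    using main unfolding l by (meson add_left_mono order_trans)
  then show ?thesis
    by (simp add: ennreal_add_left_cancel_le[of "ennreal (real L * \<delta> * q ^ m / 2)"] add.commute)
qed

text \<open>Averaging the bound for one block over the holes of the other blocks, and adding up the blocks,
  bounds the average over all configurations \<open>\<theta>\<close>; some configuration is at least as bad as the average. If
  none were as bad as claimed, then all the integrals would be finite, which permits the computation to be done with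
  real numbers.\<close>

lemma hard_configuration:
  assumes m: "0 < m"
  shows "\<exists>\<theta>\<in>PiE {..<m} (\<lambda>_. {..<L}). ennreal (real m * \<delta> / 2)
    \<le> (\<Sum>b<m. \<integral>\<^sup>+x. V b (\<theta> b) x \<partial>uniform_measure M {x\<in>space M. \<forall>b\<in>{..<m}. x \<in> Z b (\<theta> b)})"
proof (rule ccontr)
  let ?T = "PiE {..<m} (\<lambda>_. {..<L})"
  let ?W = "\<lambda>\<theta>. {x\<in>space M. \<forall>b\<in>{..<m}. x \<in> Z b (\<theta> b)}"
  define v where "v \<theta> b = (\<integral>\<^sup>+x. V b (\<theta> b) x * indicator (?W \<theta>) x \<partial>M)" for \<theta> b
  assume "\<not> ?thesis"
  then have less: "(\<Sum>b<m. \<integral>\<^sup>+x. V b (\<theta> b) x \<partial>uniform_measure M (?W \<theta>)) < ennreal (real m * \<delta> / 2)"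
    if "\<theta> \<in> ?T" for \<theta> using that by (meson not_le)
  have W: "?W \<theta> \<in> events" for \<theta> using Z by (intro sets.sets_Collect_finite_All) auto
  have eW: "emeasure M (?W \<theta>) = ennreal (q ^ m)" if "\<theta> \<in> ?T" for \<theta>
    unfolding emeasure_eq_measure using that by (subst ind) (auto simp: PiE_iff)
  have qm: "0 < q ^ m" using q by simp
  have v_less: "(\<Sum>b<m. v \<theta> b) < ennreal (real m * \<delta> / 2 * q ^ m)" if "\<theta> \<in> ?T" for \<theta>
  proof -
    have "(\<Sum>b<m. \<integral>\<^sup>+x. V b (\<theta> b) x \<partial>uniform_measure M (?W \<theta>)) = (\<Sum>b<m. v \<theta> b / ennreal (q ^ m))"
      unfolding v_def using V W by (intro sum.cong refl) (simp add: nn_integral_uniform_measure eW[OF that])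
    also have "\<dots> = (\<Sum>b<m. v \<theta> b) / ennreal (q ^ m)"
      by (simp add: divide_ennreal_def sum_distrib_right)
    finally have "(\<Sum>b<m. v \<theta> b) / ennreal (q ^ m) < ennreal (real m * \<delta> / 2)" using less[OF that] by simp
    then have "(\<Sum>b<m. v \<theta> b) / ennreal (q ^ m) * ennreal (q ^ m) < ennreal (real m * \<delta> / 2) * ennreal (q ^ m)"
      using qm by (intro ennreal_mult_strict_right_mono) auto
    moreover have "(\<Sum>b<m. v \<theta> b) / ennreal (q ^ m) * ennreal (q ^ m) = (\<Sum>b<m. v \<theta> b)"
      using q(1) by (simp add: ennreal_divide_times divide_ennreal less_imp_le)
    moreover have "ennreal (real m * \<delta> / 2) * ennreal (q ^ m) = ennreal (real m * \<delta> / 2 * q ^ m)"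
      using \<delta> by (intro ennreal_mult'[symmetric]) simp
    ultimately show ?thesis by (simp only:)
  qed
  \<comment> \<open>all values are finite by the contradiction hypothesis\<close>
  define r where "r \<theta> b = enn2real (v \<theta> b)" for \<theta> b
  have r: "v \<theta> b = ennreal (r \<theta> b)" if "\<theta> \<in> ?T" "b < m" for \<theta> b
  proof -
    have "v \<theta> b \<le> (\<Sum>b<m. v \<theta> b)" using that by (intro member_le_sum) auto
    also have "\<dots> < \<top>" using v_less[OF that(1)] by (rule less_trans) simp
    finally show ?thesis unfolding r_def by simp
  qed
  have r0: "0 \<le> r \<theta> b" for \<theta> b by (simp add: r_def)
  have upper: "(\<Sum>b<m. r \<theta> b) < real m * \<delta> / 2 * q ^ m" if "\<theta> \<in> ?T" for \<theta>
  proof -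
    have "ennreal (\<Sum>b<m. r \<theta> b) = (\<Sum>b<m. v \<theta> b)" using r[OF that] r0 by simp
    then have "ennreal (\<Sum>b<m. r \<theta> b) < ennreal (real m * \<delta> / 2 * q ^ m)"
      using v_less[OF that] by (simp only:)
    then show ?thesis by (rule ennreal_less_iff[THEN iffD1, rotated]) (simp add: sum_nonneg r0)
  qed
  have lower: "real L * \<delta> * q ^ m / 2 \<le> (\<Sum>k<L. r (\<theta>(b := k)) b)" if \<theta>: "\<theta> \<in> ?T" and b: "b < m" for \<theta> b
  proof -
    have upd: "\<theta>(b := k) \<in> ?T" if "k < L" for k
      using that \<theta> b by (auto simp: PiE_iff extensional_def)
    have "ennreal (real L * \<delta> * q ^ m / 2) \<le> (\<Sum>k<L. v (\<theta>(b := k)) b)"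
      using block_average[OF b, of \<theta>] \<theta> by (simp add: v_def PiE_iff)
    also have "\<dots> = (\<Sum>k<L. ennreal (r (\<theta>(b := k)) b))" using r[OF upd b] by simp
    also have "\<dots> = ennreal (\<Sum>k<L. r (\<theta>(b := k)) b)" using r0 by simp
    finally show ?thesis by (simp add: ennreal_le_iff sum_nonneg r0)
  qed
  have L: "0 < real L" using q by (cases "L = 0") auto
  have fin: "finite ?T" by (intro finite_PiE) auto
  have "(\<lambda>b\<in>{..<m}. 0) \<in> ?T" using L by auto
  then have ne: "?T \<noteq> {}" by blast
  have avg: "real (card ?T) * (\<delta> * q ^ m / 2) \<le> (\<Sum>\<theta>\<in>?T. r \<theta> b)" if b: "b < m" for b
  proof -
    have "(\<Sum>\<theta>\<in>?T. real L * \<delta> * q ^ m / 2) \<le> (\<Sum>\<theta>\<in>?T. \<Sum>k<L. r (\<theta>(b := k)) b)"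
      using lower b by (intro sum_mono) auto
    also have "\<dots> = real L * (\<Sum>\<theta>\<in>?T. r \<theta> b)" by (rule sum_PiE_resample[OF b])
    finally have "real L * (real (card ?T) * (\<delta> * q ^ m / 2)) \<le> real L * (\<Sum>\<theta>\<in>?T. r \<theta> b)"
      by (simp add: mult_ac)
    then show ?thesis using L by (simp only: mult_le_cancel_left_pos)
  qed
  have "real m * (real (card ?T) * (\<delta> * q ^ m / 2)) = (\<Sum>b<m. real (card ?T) * (\<delta> * q ^ m / 2))" by simp
  also have "\<dots> \<le> (\<Sum>b<m. \<Sum>\<theta>\<in>?T. r \<theta> b)" using avg by (intro sum_mono) auto
  also have "\<dots> = (\<Sum>\<theta>\<in>?T. \<Sum>b<m. r \<theta> b)" by (rule sum.swap)
  also have "\<dots> < (\<Sum>\<theta>\<in>?T. real m * \<delta> / 2 * q ^ m)"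
    using fin ne upper by (intro sum_strict_mono) auto
  finally show False by (simp add: mult_ac)
qed

end
end

section \<open>The minimax bound\<close>

lemma base_law_exists:
  assumes n: "0 < n"
  shows "\<exists>P. poisson_process_law (density lborel (\<lambda>x. ennreal (real n * indicator (cell 0 0) x))) P"
proof -
  define U where "U = uniform_measure lborel {0..<1::real}"
  have U: "prob_space U" "sets U = sets borel"
    unfolding U_def by (auto intro!: prob_space_uniform_measure)
  have "density lborel (\<lambda>x. ennreal (real n * indicator (cell 0 0) x)) = scale_measure (ennreal (real n)) U"
  proof (rule measure_eqI)
    fix A assume "A \<in> sets (density lborel (\<lambda>x. ennreal (real n * indicator (cell 0 0) x)))"
    then have A: "A \<in> sets borel" by simp
    have "emeasure (density lborel (\<lambda>x. ennreal (real n * indicator (cell 0 0) x))) A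
        = (\<integral>\<^sup>+x. ennreal (real n) * indicator ({0..<1} \<inter> A) x \<partial>lborel)"
      using A by (subst emeasure_density) (auto simp: cell_unit ennreal_mult' intro!: nn_integral_cong split: split_indicator)
    also have "\<dots> = ennreal (real n) * emeasure lborel ({0..<1} \<inter> A)"
      using A by (intro nn_integral_cmult_indicator) auto
    finally show "emeasure (density lborel (\<lambda>x. ennreal (real n * indicator (cell 0 0) x))) A
        = emeasure (scale_measure (ennreal (real n)) U) A"
      using A by (simp add: U_def emeasure_uniform_measure divide_ennreal_def)
  qed (simp add: U)
  then show ?thesis using poisson_process_law_exists[OF U, of "real n"] n by auto
qed

lemma void_event_Union:
  assumes law: "poisson_process_law \<mu> P" and A: "\<And>b. b \<in> S \<Longrightarrow> A b \<in> sets borel" and S: "finite S"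
  shows "void_event P (\<Union>b\<in>S. A b) = {N\<in>space P. \<forall>b\<in>S. N \<in> void_event P (A b)}"
proof -
  have "emeasure N (\<Union>b\<in>S. A b) = 0 \<longleftrightarrow> (\<forall>b\<in>S. emeasure N (A b) = 0)" if "N \<in> space P" for N
  proof
    have sets: "sets N = sets borel" using that space_poisson_process_law[OF law] by (simp add: point_measures_def)
    show "emeasure N (\<Union>b\<in>S. A b) = 0" if zero: "\<forall>b\<in>S. emeasure N (A b) = 0"
    proof -
      have "(\<Union>b\<in>S. A b) \<in> null_sets N"
        using A zero S sets by (intro null_sets.finite_UN) (auto simp: null_sets_def)
      then show ?thesis by (simp add: null_sets_def)
    qed
    assume zero: "emeasure N (\<Union>b\<in>S. A b) = 0"
    have U: "(\<Union>b\<in>S. A b) \<in> sets N" using A S sets by (intro sets.finite_UN) auto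
    show "\<forall>b\<in>S. emeasure N (A b) = 0"
    proof
      fix b assume "b \<in> S"
      then have "emeasure N (A b) \<le> emeasure N (\<Union>b\<in>S. A b)" using U by (intro emeasure_mono) auto
      then show "emeasure N (A b) = 0" using zero by simp
    qed
  qed
  then show ?thesis by (auto simp: void_event_def)
qed

text \<open>The squared \<open>L\<^sub>2\<close> loss is at least the sum of the losses \<open>V\<close> over the blocks, and on block \<open>b\<close> the carved
  indicator depends only on the position \<open>\<theta> b\<close> of the hole there. For two different positions the
  losses add up to at least half the squared distance of the two candidates, that is, to at least
  \<open>2^(-J)\<close>.\<close>

theorem risk_lower_bound:
  assumes n: "0 < n" and IJ: "I \<le> J" and many: "2 \<le> 2 ^ (J - I) * exp (- real n / 2 ^ J)"
    and g: "g \<in> estimators"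
  shows "\<exists>p. (\<forall>b<2 ^ I. p b div 2 ^ (J - I) = b) \<and>
    (\<exists>P\<in>poisson_laws n (indicator (carved I J p)).
      ennreal (2 ^ I / 2 ^ J / 4) \<le> L2_risk P g (indicator (carved I J p)))"
proof -
  define \<mu> where "\<mu> = density lborel (\<lambda>x. ennreal (real n * indicator (cell 0 0) x))"
  obtain P where law: "poisson_process_law \<mu> P" using base_law_exists[OF n] by (auto simp: \<mu>_def)
  interpret prob_space P using law by (simp add: poisson_process_law_def)
  have sets_mu: "sets \<mu> = sets borel" by (simp add: \<mu>_def)
  have sets_P: "sets P = sets point_algebra" using law by (simp add: poisson_process_law_def)
  define L where "L = (2::nat) ^ (J - I)"
  have L: "0 < L" by (simp add: L_def)
  define H where "H b k = cell J (b * L + k)" for b k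
  have H_div: "(b * L + k) div L = b" if "k < L" for b k using that by simp
  have H_sub: "H b k \<subseteq> cell I b" if "k < L" for b k
    using cell_subset[OF IJ, of "b * L + k"] H_div[OF that, of b] by (simp add: H_def L_def)
  define V where "V b k N = (\<integral>\<^sup>+x. ennreal ((g N x - (1 - indicator (H b k) x))\<^sup>2) * indicator (cell I b) x \<partial>lborel)" for b k N
  define q where "q = exp (- real n / 2 ^ J)"
  define m where "m = (2::nat) ^ I"
  have mu_cells: "emeasure \<mu> (\<Union>b\<in>S. H b (\<theta> b)) = ennreal (real n * (real (card S) / 2 ^ J))"
    if S: "S \<subseteq> {..<m}" and \<theta>: "\<And>b. b \<in> S \<Longrightarrow> \<theta> b < L" for S \<theta>
  proof -
    have fin: "finite S" using S finite_subset by blast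
    have sub: "(\<Union>b\<in>S. H b (\<theta> b)) \<subseteq> cell 0 0"
    proof -
      have "H b (\<theta> b) \<subseteq> cell 0 0" if "b \<in> S" for b
      proof -
        have "b < 2 ^ I" using S that by (auto simp: m_def)
        then have "cell I b \<subseteq> cell 0 0" using cell_subset[of 0 I b] by simp
        then show ?thesis using H_sub[OF \<theta>[OF that], of b] by blast
      qed
      then show ?thesis by blast
    qed
    have meas: "(\<Union>b\<in>S. H b (\<theta> b)) \<in> sets borel" using fin by (intro sets.finite_UN) (auto simp: H_def)
    have "emeasure \<mu> (\<Union>b\<in>S. H b (\<theta> b)) = (\<integral>\<^sup>+x. ennreal (real n) * indicator (\<Union>b\<in>S. H b (\<theta> b)) x \<partial>lborel)"
    proof -
      have "ennreal (real n * indicator (cell 0 0) x) * indicator (\<Union>b\<in>S. H b (\<theta> b)) x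
          = ennreal (real n) * indicator (\<Union>b\<in>S. H b (\<theta> b)) x" for x
        using sub by (cases "x \<in> (\<Union>b\<in>S. H b (\<theta> b))") (auto simp del: UN_iff)
      then show ?thesis unfolding \<mu>_def using meas by (subst emeasure_density) simp_all
    qed
    also have "\<dots> = ennreal (real n) * emeasure lborel (\<Union>b\<in>S. H b (\<theta> b))"
      using meas by (intro nn_integral_cmult_indicator) auto
    also have "emeasure lborel (\<Union>b\<in>S. H b (\<theta> b)) = (\<Sum>b\<in>S. emeasure lborel (H b (\<theta> b)))"
    proof (rule sum_emeasure[symmetric])
      show "disjoint_family_on (\<lambda>b. H b (\<theta> b)) S"
        unfolding disjoint_family_on_def
      proof (intro ballI impI)
        fix b b' assume "b \<in> S" "b' \<in> S" "b \<noteq> b'"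
        then show "H b (\<theta> b) \<inter> H b' (\<theta> b') = {}"
          using H_sub[of "\<theta> b" b] H_sub[of "\<theta> b'" b'] \<theta> disjoint_cell[of b b' I] by blast
      qed
    qed (use fin in \<open>auto simp: H_def\<close>)
    also have "\<dots> = ennreal (real (card S) / 2 ^ J)"
      by (simp add: H_def measure_cell ennreal_of_nat_eq_real_of_nat ennreal_mult'[symmetric])
    finally show ?thesis by (simp add: ennreal_mult'[symmetric])
  qed
  have void_prob: "prob (void_event P (\<Union>b\<in>S. H b (\<theta> b))) = q ^ card S"
    if S: "S \<subseteq> {..<m}" and \<theta>: "\<And>b. b \<in> S \<Longrightarrow> \<theta> b < L" for S \<theta>
  proof -
    have "finite S" using S finite_subset by blast
    then have "(\<Union>b\<in>S. H b (\<theta> b)) \<in> sets borel" by (intro sets.finite_UN) (auto simp: H_def)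
    then have "prob (void_event P (\<Union>b\<in>S. H b (\<theta> b))) = exp (- measure \<mu> (\<Union>b\<in>S. H b (\<theta> b)))"
      by (intro measure_void_event[OF law]) (simp_all add: mu_cells[OF S \<theta>])
    also have "measure \<mu> (\<Union>b\<in>S. H b (\<theta> b)) = real n * (real (card S) / 2 ^ J)"
      by (simp add: measure_def mu_cells[OF S \<theta>])
    also have "exp (- (real n * (real (card S) / 2 ^ J))) = q ^ card S"
      unfolding q_def by (simp add: exp_of_nat_mult[symmetric])
    finally show ?thesis .
  qed
  have V_meas: "V b k \<in> borel_measurable P" for b k
  proof -
    have [measurable]: "(\<lambda>(N, x). g N x) \<in> borel_measurable (point_algebra \<Otimes>\<^sub>M lborel)"
      using g by (simp add: estimators_def)
    have [measurable]: "H b k \<in> sets lborel" "cell I b \<in> sets lborel" by (simp_all add: H_def)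
    have "(\<lambda>(N, x). ennreal ((g N x - (1 - indicator (H b k) x))\<^sup>2) * indicator (cell I b) x)
      \<in> borel_measurable (point_algebra \<Otimes>\<^sub>M lborel)"
      by measurable
    then have "V b k \<in> borel_measurable point_algebra"
      unfolding V_def by (rule lborel.borel_measurable_nn_integral)
    then show ?thesis using sets_P by (simp cong: measurable_cong_sets)
  qed
  have sep: "ennreal (2 * (1 / 2 ^ J / 2)) \<le> V b k N + V b k' N"
    if N: "N \<in> space P" and k: "k < L" "k' < L" "k \<noteq> k'" for N b k k'
  proof -
    let ?d = "\<lambda>k x. ennreal ((g N x - (1 - indicator (H b k) x))\<^sup>2) * indicator (cell I b) x"
    have "(\<lambda>(N, x). g N x) \<in> borel_measurable (point_algebra \<Otimes>\<^sub>M lborel)"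
      using g by (simp add: estimators_def)
    moreover have "N \<in> space point_algebra" using N sets_eq_imp_space_eq[OF sets_P] by simp
    ultimately have [measurable]: "g N \<in> borel_measurable lborel"
      using measurable_Pair2[of "\<lambda>(N, x). g N x" point_algebra lborel borel N] by simp
    have [measurable]: "H b k \<in> sets lborel" "cell I b \<in> sets lborel" for k by (simp_all add: H_def)
    have disj: "H b k \<inter> H b k' = {}" unfolding H_def using k by (intro disjoint_cell) simp
    have "ennreal (1 / 2) * indicator (H b k \<union> H b k') x \<le> ?d k x + ?d k' x" for x
    proof (cases "x \<in> H b k \<union> H b k'")
      case True
      then have cell: "x \<in> cell I b" using H_sub k by blast
      have ind: "indicator (H b k) x + indicator (H b k') x = (1 :: real)"
        using True disj by (auto simp: indicator_def)
      have sq: "1 / 2 \<le> (a - (1 - u))\<^sup>2 + (a - (1 - u'))\<^sup>2" if "u + u' = 1" "u * u' = 0" for a u u' :: real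
      proof -
        have lin: "1 / 2 \<le> B" if "A + C = 2 * B" "C = 1" "0 \<le> A" for A B C :: real
          using that by linarith
        \<comment> \<open>parallelogram identity\<close>
        have "((a - (1 - u)) + (a - (1 - u')))\<^sup>2 + (u - u')\<^sup>2 = 2 * ((a - (1 - u))\<^sup>2 + (a - (1 - u'))\<^sup>2)"
          by (simp add: power2_eq_square algebra_simps)
        moreover have "(u - u')\<^sup>2 = (u + u')\<^sup>2 - 4 * (u * u')" by (simp add: power2_eq_square algebra_simps)
        then have "(u - u')\<^sup>2 = 1" unfolding that by simp
        moreover have "0 \<le> ((a - (1 - u)) + (a - (1 - u')))\<^sup>2" by (rule zero_le_power2)
        ultimately show ?thesis by (rule lin)
      qed
      have "indicator (H b k) x * indicator (H b k') x = (0 :: real)" using disj by (auto simp: indicator_def)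
      from sq[OF ind this, of "g N x"]
      have "ennreal (1 / 2) \<le> ennreal ((g N x - (1 - indicator (H b k) x))\<^sup>2 + (g N x - (1 - indicator (H b k') x))\<^sup>2)"
        by (rule ennreal_leI)
      then show ?thesis using True cell by (simp add: ennreal_plus)
    qed simp
    then have "(\<integral>\<^sup>+x. ennreal (1 / 2) * indicator (H b k \<union> H b k') x \<partial>lborel) \<le> (\<integral>\<^sup>+x. ?d k x + ?d k' x \<partial>lborel)"
      by (intro nn_integral_mono) simp
    also have "\<dots> = V b k N + V b k' N"
      unfolding V_def by (rule nn_integral_add) measurable
    also have "(\<integral>\<^sup>+x. ennreal (1 / 2) * indicator (H b k \<union> H b k') x \<partial>lborel)
        = ennreal (1 / 2) * emeasure lborel (H b k \<union> H b k')"
      by (rule nn_integral_cmult_indicator) measurable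
    also have "emeasure lborel (H b k \<union> H b k') = emeasure lborel (H b k) + emeasure lborel (H b k')"
      using disj by (intro plus_emeasure[symmetric]) (simp_all add: H_def)
    also have "\<dots> = ennreal (2 / 2 ^ J)"
      by (simp add: H_def measure_cell ennreal_plus[symmetric] del: ennreal_plus)
    also have "ennreal (1 / 2) * ennreal (2 / 2 ^ J) = ennreal (2 * (1 / 2 ^ J / 2))"
      by (subst ennreal_mult[symmetric]) simp_all
    finally show ?thesis .
  qed
  have "\<exists>\<theta>\<in>PiE {..<m} (\<lambda>_. {..<L}). ennreal (real m * (1 / 2 ^ J / 2) / 2)
    \<le> (\<Sum>b<m. \<integral>\<^sup>+N. V b (\<theta> b) N \<partial>uniform_measure P {N\<in>space P. \<forall>b\<in>{..<m}. N \<in> void_event P (H b (\<theta> b))})"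
  proof (rule hard_configuration[where q = q])
    show "void_event P (H b k) \<in> events" for b k
      by (rule void_event_sets[OF law]) (simp add: H_def)
    show "prob {N\<in>space P. \<forall>b\<in>S. N \<in> void_event P (H b (\<theta> b))} = q ^ card S"
      if "S \<subseteq> {..<m}" "\<And>b. b \<in> S \<Longrightarrow> \<theta> b < L" for S \<theta>
    proof -
      have "void_event P (\<Union>b\<in>S. H b (\<theta> b)) = {N\<in>space P. \<forall>b\<in>S. N \<in> void_event P (H b (\<theta> b))}"
        using finite_subset[OF that(1)] by (intro void_event_Union[OF law]) (auto simp: H_def)
      then show ?thesis using void_prob[of S \<theta>] that by simp
    qed
  qed (use V_meas sep many in \<open>auto simp: q_def L_def m_def\<close>)
  then obtain \<theta> where \<theta>: "\<theta> \<in> PiE {..<m} (\<lambda>_. {..<L})"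
    and risk: "ennreal (real m * (1 / 2 ^ J / 2) / 2)
    \<le> (\<Sum>b<m. \<integral>\<^sup>+N. V b (\<theta> b) N \<partial>uniform_measure P {N\<in>space P. \<forall>b\<in>{..<m}. N \<in> void_event P (H b (\<theta> b))})"
    by blast
  define p where "p b = b * L + \<theta> b" for b
  define A where "A = (\<Union>b<m. H b (\<theta> b))"
  define Q where "Q = uniform_measure P (void_event P A)"
  have \<theta>_less: "\<theta> b < L" if "b < m" for b using \<theta> that by auto
  have p_div: "p b div 2 ^ (J - I) = b" if "b < 2 ^ I" for b
    using H_div[OF \<theta>_less, of b] that by (simp add: p_def L_def m_def)
  have H_p: "H b (\<theta> b) = cell J (p b)" for b by (simp add: H_def p_def)
  have carved_eq: "carved I J p = cell 0 0 - A" by (simp add: carved_def A_def H_p m_def)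
  have A: "A \<in> sets borel" unfolding A_def by (intro sets.finite_UN) (auto simp: H_def)
  have voids: "void_event P A = {N\<in>space P. \<forall>b\<in>{..<m}. N \<in> void_event P (H b (\<theta> b))}"
    unfolding A_def by (rule void_event_Union[OF law]) (auto simp: H_def)
  have "poisson_process_law (density \<mu> (indicator (- A))) Q"
    unfolding Q_def
  proof (rule poisson_process_law_void[OF law sets_mu A])
    show "emeasure \<mu> A < \<infinity>" unfolding A_def by (subst mu_cells) (simp_all add: \<theta>_less)
  qed
  moreover have "density \<mu> (indicator (- A)) = density lborel (\<lambda>x. ennreal (real n * indicator (carved I J p) x))"
    unfolding \<mu>_def carved_eq using A
    by (subst density_density_eq) (auto intro!: density_cong split: split_indicator)
  ultimately have Q: "Q \<in> poisson_laws n (indicator (carved I J p))"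
    by (simp add: poisson_laws_def)
  have "ennreal (2 ^ I / 2 ^ J / 4) \<le> (\<Sum>b<m. \<integral>\<^sup>+N. V b (\<theta> b) N \<partial>Q)"
    using risk unfolding voids[symmetric] Q_def by (simp add: m_def mult.commute[of 4])
  also have "\<dots> = (\<integral>\<^sup>+N. (\<Sum>b<m. V b (\<theta> b) N) \<partial>Q)"
    using V_meas by (intro nn_integral_sum[symmetric]) (simp add: Q_def)
  also have "\<dots> \<le> L2_risk Q g (indicator (carved I J p))"
    unfolding L2_risk_def
  proof (rule nn_integral_mono)
    fix N assume "N \<in> space Q"
    then have "N \<in> space point_algebra" using sets_eq_imp_space_eq[OF sets_P] by (simp add: Q_def)
    moreover have "(\<lambda>(N, x). g N x) \<in> borel_measurable (point_algebra \<Otimes>\<^sub>M lborel)"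
      using g by (simp add: estimators_def)
    ultimately have [measurable]: "g N \<in> borel_measurable lborel"
      using measurable_Pair2[of "\<lambda>(N, x). g N x" point_algebra lborel borel N] by simp
    have [measurable]: "H b k \<in> sets lborel" "cell I b \<in> sets lborel" for b k by (simp_all add: H_def)
    let ?e = "\<lambda>x. ennreal ((g N x - indicator (carved I J p) x)\<^sup>2)"
    have local: "indicator (carved I J p) x = (1 - indicator (H b (\<theta> b)) x :: real)" if b: "b < m" and x: "x \<in> cell I b" for b x
    proof -
      have "x \<in> cell 0 0" using cell_subset[of 0 I b] b x by (auto simp: m_def)
      moreover have "x \<notin> H b' (\<theta> b')" if "b' < m" "b' \<noteq> b" for b'
        using H_sub[OF \<theta>_less[OF that(1)], of b'] disjoint_cell[OF that(2), of I] x by blast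
      ultimately show ?thesis using b unfolding carved_eq A_def by (auto simp: indicator_def)
    qed
    have "(\<Sum>b<m. V b (\<theta> b) N) = (\<integral>\<^sup>+x. (\<Sum>b<m. ennreal ((g N x - (1 - indicator (H b (\<theta> b)) x))\<^sup>2) * indicator (cell I b) x) \<partial>lborel)"
      unfolding V_def by (intro nn_integral_sum[symmetric]) measurable
    also have "\<dots> \<le> (\<integral>\<^sup>+x. ?e x \<partial>lborel)"
    proof (rule nn_integral_mono)
      fix x :: real
      have "(\<Sum>b<m. ennreal ((g N x - (1 - indicator (H b (\<theta> b)) x))\<^sup>2) * indicator (cell I b) x)
          = (\<Sum>b<m. ?e x * indicator (cell I b) x)"
        using local by (intro sum.cong refl) (auto split: split_indicator)
      also have "\<dots> = ?e x * (\<Sum>b<m. indicator (cell I b) x)" by (rule sum_distrib_left[symmetric])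
      also have "(\<Sum>b<m. indicator (cell I b) x :: ennreal) = indicator (\<Union>b<m. cell I b) x"
        by (rule indicator_UN_disjoint[symmetric]) (auto simp: disjoint_family_on_def disjoint_cell)
      also have "?e x * \<dots> \<le> ?e x * 1" by (intro mult_left_mono) (auto split: split_indicator)
      finally show "(\<Sum>b<m. ennreal ((g N x - (1 - indicator (H b (\<theta> b)) x))\<^sup>2) * indicator (cell I b) x) \<le> ?e x" by simp
    qed
    finally show "(\<Sum>b<m. V b (\<theta> b) N) \<le> (\<integral>\<^sup>+x. ?e x \<partial>lborel)" .
  qed
  finally show ?thesis using p_div Q by blast
qed

lemma dyadic_bracket:
  fixes x :: real
  assumes "1 \<le> x"
  obtains i :: nat where "2 ^ i \<le> x" "x < 2 * 2 ^ i"
proof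
  define l where "l = \<lfloor>log 2 x\<rfloor>"
  have l0: "0 \<le> l" using assms by (simp add: l_def)
  have l: "of_int l \<le> log 2 x" "log 2 x < of_int l + 1" by (simp_all add: l_def floor_correct)
  have "2 powr of_int l \<le> x" "x < 2 powr (of_int l + 1)"
    using l assms by (simp_all add: le_log_iff[symmetric] log_less_iff[symmetric])
  moreover have "2 powr of_int l = (2::real) ^ nat l"
    using l0 by (simp add: powr_real_of_int)
  ultimately show "2 ^ nat l \<le> x" "x < 2 * 2 ^ nat l" by (simp_all add: powr_add)
qed

text \<open>Take \<open>2^J\<close> between \<open>n / (s * ln n)\<close> and twice that number, so that a cell is empty with probability
  at least \<open>n^(-s)\<close>, and take \<open>2^I\<close> maximal subject to the restriction from the classes. A block then consists
  of at least \<open>4 * (2^J)^(2s) / K\<close> cells, which outgrows \<open>2 * n^s\<close> because \<open>2 * s > s\<close>.\<close>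

lemma choice_of_levels:
  fixes s K :: real
  assumes s: "0 < s" "s < 1 / 2" and K: "1 \<le> K"
  shows "\<forall>\<^sub>F n :: nat in sequentially. \<exists>I J. I \<le> J \<and> 0 < n \<and> 2 ^ I \<le> K * (2 ^ J) powr (1 - 2 * s) / 4 \<and>
    2 \<le> 2 ^ (J - I) * exp (- real n / 2 ^ J) \<and>
    (s / 2) powr (2 * s) / 32 * K * (ln (real n) / real n) powr (2 * s) \<le> 2 ^ I / 2 ^ J / 4"
proof -
  have e1: "\<forall>\<^sub>F n :: nat in sequentially. 1 \<le> real n / ln (real n) / s"
    using s by real_asymp
  \<comment> \<open>makes the bound for \<open>2^I\<close> at least \<open>1\<close>, so that a level \<open>I\<close> exists\<close>
  have e2: "\<forall>\<^sub>F n :: nat in sequentially. 4 \<le> (real n / ln (real n) / s) powr (1 - 2 * s)"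
    using s by real_asymp
  \<comment> \<open>makes a block contain at least two empty cells on average\<close>
  have e3: "\<forall>\<^sub>F n :: nat in sequentially. K / 2 * real n powr s \<le> (real n / ln (real n) / s) powr (2 * s)"
    using s K by real_asymp
  show ?thesis
    using e1 e2 e3 eventually_ge_at_top[of 2]
  proof eventually_elim
    case (elim n)
    define y where "y = real n / ln (real n)"
    have n: "0 < n" "0 < ln (real n)" using elim(4) by auto
    have y: "0 < y" using n by (simp add: y_def)
    obtain i :: nat where i: "2 ^ i \<le> y / s" "y / s < 2 * 2 ^ i"
      using dyadic_bracket[of "y / s"] elim(1) unfolding y_def by blast
    define J where "J = Suc i"
    have J: "y / s \<le> 2 ^ J" "2 ^ J \<le> 2 * (y / s)" using i by (auto simp: J_def)
    have J1: "(y / s) powr (1 - 2 * s) \<le> (2 ^ J) powr (1 - 2 * s)"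
      using J y s by (intro powr_mono2) auto
    then have "4 \<le> (2 ^ J) powr (1 - 2 * s)" using elim(2) by (simp add: y_def)
    then have "1 * 4 \<le> K * (2 ^ J) powr (1 - 2 * s)" using K by (intro mult_mono) auto
    then have "1 \<le> K * (2 ^ J) powr (1 - 2 * s) / 4" by simp
    then obtain I :: nat where I: "2 ^ I \<le> K * (2 ^ J) powr (1 - 2 * s) / 4" "K * (2 ^ J) powr (1 - 2 * s) / 4 < 2 * 2 ^ I"
      using dyadic_bracket by blast
    have split: "(2 ^ J) powr (1 - 2 * s) * (2 ^ J) powr (2 * s) = (2::real) ^ J"
      by (simp add: powr_add[symmetric])
    have "real n / 2 ^ J \<le> s * ln (real n)"
    proof -
      have "real n / s \<le> 2 ^ J * ln (real n)" using J(1) n s by (simp add: y_def field_simps)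
      then show ?thesis using s by (simp add: field_simps)
    qed
    then have "exp (real n / 2 ^ J) \<le> real n powr s" using n by (simp add: powr_def)
    then have "2 ^ I * (2 * exp (real n / 2 ^ J)) \<le> (K * (2 ^ J) powr (1 - 2 * s) / 4) * (2 * real n powr s)"
      using I(1) K by (intro mult_mono) auto
    also have "\<dots> = (2 ^ J) powr (1 - 2 * s) * (K / 2 * real n powr s)" by simp
    also have "\<dots> \<le> (2 ^ J) powr (1 - 2 * s) * (y / s) powr (2 * s)"
      using elim(3) by (intro mult_left_mono) (auto simp: y_def)
    also have "\<dots> \<le> (2 ^ J) powr (1 - 2 * s) * (2 ^ J) powr (2 * s)"
      using J y s by (intro mult_left_mono powr_mono2) auto
    finally have many: "2 ^ I * (2 * exp (real n / 2 ^ J)) \<le> 2 ^ J" unfolding split .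
    have "1 \<le> exp (real n / 2 ^ J)" by simp
    then have "1 \<le> 2 * exp (real n / 2 ^ J)" by linarith
    then have "(2::real) ^ I * 1 \<le> 2 ^ I * (2 * exp (real n / 2 ^ J))" by (intro mult_left_mono) auto
    then have "(2::real) ^ I \<le> 2 ^ J" using many by linarith
    then have IJ: "I \<le> J" by (simp add: power_increasing_iff)
    have "(2::real) ^ J = 2 ^ I * 2 ^ (J - I)" using IJ by (simp add: power_add[symmetric])
    then have "2 * exp (real n / 2 ^ J) \<le> 2 ^ (J - I)" using many by simp
    then have many': "2 \<le> 2 ^ (J - I) * exp (- real n / 2 ^ J)"
      by (simp add: exp_minus field_simps)
    have "(s / 2) powr (2 * s) * (ln (real n) / real n) powr (2 * s) = (2 * (y / s)) powr (- (2 * s))"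
    proof -
      have "(s / 2) powr (2 * s) * (ln (real n) / real n) powr (2 * s) = (s / 2 * (ln (real n) / real n)) powr (2 * s)"
        using s n by (subst powr_mult) simp_all
      also have "s / 2 * (ln (real n) / real n) = inverse (2 * (y / s))" by (simp add: y_def)
      also have "\<dots> powr (2 * s) = (2 * (y / s)) powr (- (2 * s))"
        unfolding powr_minus by (rule inverse_powr)
      finally show ?thesis .
    qed
    also have "\<dots> \<le> (2 ^ J) powr (- (2 * s))"
      using J y s by (intro powr_mono2') auto
    finally have "(s / 2) powr (2 * s) / 32 * K * (ln (real n) / real n) powr (2 * s) \<le> K / 32 * (2 ^ J) powr (- (2 * s))"
      using K by (simp add: mult_ac)
    also have "(2 ^ J) powr (- (2 * s)) = (2 ^ J) powr (1 - 2 * s) / 2 ^ J"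
      using powr_add[of "2 ^ J" "1 - 2 * s" "-1"] by (simp add: powr_minus field_simps)
    also have "K / 32 * ((2 ^ J) powr (1 - 2 * s) / 2 ^ J) = K * (2 ^ J) powr (1 - 2 * s) / 4 / 2 / 2 ^ J / 4" by simp
    also have "\<dots> \<le> 2 * 2 ^ I / 2 / 2 ^ J / 4"
      using I(2) by (intro divide_right_mono) auto
    finally have "(s / 2) powr (2 * s) / 32 * K * (ln (real n) / real n) powr (2 * s) \<le> 2 ^ I / 2 ^ J / 4" by simp
    then show ?case using IJ n many' I(1) by blast
  qed
qed

theorem theorem6:
  fixes s :: real
  assumes "0 < s" and "s < 1 / 2"
  shows "\<exists>C>0. \<forall>R R' R'' :: real.
    0 < R \<and> 0 < R' \<and> 0 < R'' \<and> 1 \<le> R'' \<and> R powr (1 - 2 * s) \<le> R' \<and> 1 \<le> R powr (1 - 2 * s) \<longrightarrow>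
    ennreal (C * R powr (2 - 4 * s))
      \<le> liminf (\<lambda>n::nat. ennreal (inverse (((ln (real n) / real n) powr s)\<^sup>2)) *
          (INF g\<in>estimators.
             SUP f\<in>W_class s R \<inter> B_class s Gam R' \<inter> L_class R'' \<inter> intensities.
               SUP P\<in>poisson_laws n f. L2_risk P g f))"
proof (intro exI[of _ "(s / 2) powr (2 * s) / 32"] conjI allI impI)
  show "0 < (s / 2) powr (2 * s) / 32" using assms by simp
  fix R R' R'' :: real
  assume "0 < R \<and> 0 < R' \<and> 0 < R'' \<and> 1 \<le> R'' \<and> R powr (1 - 2 * s) \<le> R' \<and> 1 \<le> R powr (1 - 2 * s)"
  then have R: "1 \<le> R''" "R powr (1 - 2 * s) \<le> R'" "1 \<le> R powr (1 - 2 * s)" by auto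
  have "1 * 1 \<le> R powr (1 - 2 * s) * R powr (1 - 2 * s)" using R(3) by (intro mult_mono) auto
  then have K: "1 \<le> R powr (2 - 4 * s)" by (simp add: powr_add[symmetric])
  let ?c = "(s / 2) powr (2 * s) / 32"
  show "ennreal (?c * R powr (2 - 4 * s))
      \<le> liminf (\<lambda>n::nat. ennreal (inverse (((ln (real n) / real n) powr s)\<^sup>2)) *
          (INF g\<in>estimators.
             SUP f\<in>W_class s R \<inter> B_class s Gam R' \<inter> L_class R'' \<inter> intensities.
               SUP P\<in>poisson_laws n f. L2_risk P g f))"
  proof (rule Liminf_bounded)
    show "\<forall>\<^sub>F n in sequentially. ennreal (?c * R powr (2 - 4 * s))
      \<le> ennreal (inverse (((ln (real n) / real n) powr s)\<^sup>2)) *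
          (INF g\<in>estimators.
             SUP f\<in>W_class s R \<inter> B_class s Gam R' \<inter> L_class R'' \<inter> intensities.
               SUP P\<in>poisson_laws n f. L2_risk P g f)"
      using choice_of_levels[OF assms K] eventually_ge_at_top[of 2]
    proof eventually_elim
      case (elim n)
      then obtain I J where IJ: "I \<le> J" and n: "0 < n"
        and I: "2 ^ I \<le> R powr (2 - 4 * s) * (2 ^ J) powr (1 - 2 * s) / 4"
        and many: "2 \<le> 2 ^ (J - I) * exp (- real n / 2 ^ J)"
        and rate: "?c * R powr (2 - 4 * s) * (ln (real n) / real n) powr (2 * s) \<le> 2 ^ I / 2 ^ J / 4"
        by blast
      have "ennreal (2 ^ I / 2 ^ J / 4) \<le> (INF g\<in>estimators.
          SUP f\<in>W_class s R \<inter> B_class s Gam R' \<inter> L_class R'' \<inter> intensities.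
            SUP P\<in>poisson_laws n f. L2_risk P g f)"
      proof (rule INF_greatest)
        fix g assume "g \<in> estimators"
        from risk_lower_bound[OF n IJ many this] obtain p P
          where p: "\<And>b. b < 2 ^ I \<Longrightarrow> p b div 2 ^ (J - I) = b"
            and P: "P \<in> poisson_laws n (indicator (carved I J p))"
            and risk: "ennreal (2 ^ I / 2 ^ J / 4) \<le> L2_risk P g (indicator (carved I J p))"
          by blast
        have sup: "ennreal (2 ^ I / 2 ^ J / 4)
            \<le> (SUP P\<in>poisson_laws n (indicator (carved I J p)). L2_risk P g (indicator (carved I J p)))"
          using P risk by (rule SUP_upper2)
        have "indicator (carved I J p) \<in> W_class s R \<inter> B_class s Gam R' \<inter> L_class R'' \<inter> intensities"
          using carved_W_class[OF IJ p assms I K] carved_B_class[OF IJ p assms I R(2)]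
            carved_L_class[OF IJ p R(1)] carved_intensity[OF IJ p] by simp
        from sup SUP_upper[OF this, of "\<lambda>f. SUP P\<in>poisson_laws n f. L2_risk P g f"]
        show "ennreal (2 ^ I / 2 ^ J / 4) \<le> (SUP f\<in>W_class s R \<inter> B_class s Gam R' \<inter> L_class R'' \<inter> intensities.
            SUP P\<in>poisson_laws n f. L2_risk P g f)"
          by (rule order_trans)
      qed
      with ennreal_leI[OF rate] have "ennreal (?c * R powr (2 - 4 * s) * (ln (real n) / real n) powr (2 * s))
          \<le> (INF g\<in>estimators.
            SUP f\<in>W_class s R \<inter> B_class s Gam R' \<inter> L_class R'' \<inter> intensities.
              SUP P\<in>poisson_laws n f. L2_risk P g f)"
        by (rule order_trans)
      then have "ennreal (inverse (((ln (real n) / real n) powr s)\<^sup>2)) *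
            ennreal (?c * R powr (2 - 4 * s) * (ln (real n) / real n) powr (2 * s))
          \<le> ennreal (inverse (((ln (real n) / real n) powr s)\<^sup>2)) * (INF g\<in>estimators.
            SUP f\<in>W_class s R \<inter> B_class s Gam R' \<inter> L_class R'' \<inter> intensities.
              SUP P\<in>poisson_laws n f. L2_risk P g f)"
        by (rule mult_left_mono) simp
      moreover have "ennreal (inverse (((ln (real n) / real n) powr s)\<^sup>2)) *
            ennreal (?c * R powr (2 - 4 * s) * (ln (real n) / real n) powr (2 * s)) = ennreal (?c * R powr (2 - 4 * s))"
      proof -
        have pos: "0 < (ln (real n) / real n) powr (2 * s)" using elim(2) by (simp del: powr_divide)
        have square: "((ln (real n) / real n) powr s)\<^sup>2 = (ln (real n) / real n) powr (2 * s)"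
          by (simp add: power2_eq_square powr_add[symmetric])
        have cancel: "inverse z * (a * z) = a" if "0 < z" for a z :: real using that by simp
        have "inverse (((ln (real n) / real n) powr s)\<^sup>2) * (?c * R powr (2 - 4 * s) * (ln (real n) / real n) powr (2 * s))
            = ?c * R powr (2 - 4 * s)"
          unfolding square by (rule cancel[OF pos])
        then show ?thesis by (subst ennreal_mult'[symmetric]) (simp_all only: inverse_nonnegative_iff_nonnegative zero_le_power2)
      qed
      ultimately show ?case by (simp only:)
    qed
  qed
qed

end
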